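(* Let $X$ be a set and let $\Omega$ be a commutative semigroup. Let $\mathbf{k}\mathcal{T}(X,\Omega)$ be the free $\mathbf{k}$-module on the set $\mathcal{T}(X,\Omega)$ of $X$-decorated $\Omega$-typed rooted trees, with the operations $\rhd_\omega$ ($\omega\in\Omega$) defined on trees $S,T$ by $S\rhd_\omega T:=\sum_{v\in V(T)} S\xrightarrow[v]{\omega}T$ and extended bilinearly. Let $j:X\to\mathbf{k}\mathcal{T}(X,\Omega)$, $x\mapsto\bullet_x$, where $\bullet_x$ is the one-vertex tree decorated by $x$. Then $(\mathbf{k}\mathcal{T}(X,\Omega),(\rhd_\omega)_{\omega\in\Omega})$ together with $j$ is the free pre-Lie family algebra on $X$; that is, it is a pre-Lie family algebra, and for every pre-Lie family algebra $(A,(\rhd'_\omega)_{\omega\in\Omega})$ and every map $\psi:X\to A$ there is a unique $\mathbf{k}$-linear map $\phi:\mathbf{k}\mathcal{T}(X,\Omega)\to A$ with $\phi(a\rhd_\omega b)=\phi(a)\rhd'_\omega\phi(b)$ for all $a,b$ and all $\omega\in\Omega$, and $\phi\circ j=\psi$.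
   Context: $\mathbf{k}$ is a unitary commutative ring. (Left) pre-Lie family algebra (over a commutative semigroup $\Omega$): a $\mathbf{k}$-module $A$ with bilinear operations $\rhd_\omega:A\times A\to A$, $\omega\in\Omega$, such that for all $x,y,z\in A$ and $\alpha,\beta\in\Omega$: $x\rhd_\alpha(y\rhd_\beta z)-(x\rhd_\alpha y)\rhd_{\alpha\beta}z=y\rhd_\beta(x\rhd_\alpha z)-(y\rhd_\beta x)\rhd_{\beta\alpha}z$. An $X$-decorated $\Omega$-typed rooted tree is a (finite, nonempty, non-planar) rooted tree $T$ together with a map $\mathrm{dec}:V(T)\to X$ on its set of vertices and a map $\mathrm{type}:E(T)\to\Omega$ on its set of edges; trees are considered up to isomorphism of rooted trees preserving decorations and types. $\mathcal{T}(X,\Omega)$ is the set of all of them. For trees $S,T$, a vertex $v$ of $T$ and $\omega\in\Omega$, the tree $S\xrightarrow[v]{\omega}T$ is obtained as follows: $S$ is grafted on $T$ at $v$ by adding a new edge of type $\omega$ between the root of $S$ and $v$ (the root of the result is the root of $T$); each edge of $T$ below $v$ (i.e. on the path from $v$ to the root of $T$) has its type multiplied by $\omega$; all other edges keep their types; decorations are unchanged. *)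

theory Defs
  imports Complex_Main "HOL-Library.Poly_Mapping" "HOL-Library.FuncSet" "HOL-Library.Nat_Bijection"
begin

section \<open>Pre-Lie family algebras\<close>

text \<open>
  The underlying module is a submodule \<open>A\<close> of the module given by \<open>scale\<close>; a module whose
  elements form a whole type is the case \<open>A = UNIV\<close>.
  \<open>act \<omega> x y\<close> stands for \<open>x \<rhd>\<^sub>\<omega> y\<close>.
\<close>

locale pre_lie_family_algebra = module scale
  for scale :: "'k::comm_ring_1 \<Rightarrow> 'a::ab_group_add \<Rightarrow> 'a" +
  fixes A :: "'a set"
    and act :: "'w::ab_semigroup_mult \<Rightarrow> 'a \<Rightarrow> 'a \<Rightarrow> 'a"
  assumes carrier: "subspace A"
    and act_closed: "\<lbrakk>x \<in> A; y \<in> A\<rbrakk> \<Longrightarrow> act \<omega> x y \<in> A"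
    and act_add_left: "\<lbrakk>x \<in> A; x' \<in> A; y \<in> A\<rbrakk> \<Longrightarrow> act \<omega> (x + x') y = act \<omega> x y + act \<omega> x' y"
    and act_add_right: "\<lbrakk>x \<in> A; y \<in> A; y' \<in> A\<rbrakk> \<Longrightarrow> act \<omega> x (y + y') = act \<omega> x y + act \<omega> x y'"
    and act_scale_left: "\<lbrakk>x \<in> A; y \<in> A\<rbrakk> \<Longrightarrow> act \<omega> (scale c x) y = scale c (act \<omega> x y)"
    and act_scale_right: "\<lbrakk>x \<in> A; y \<in> A\<rbrakk> \<Longrightarrow> act \<omega> x (scale c y) = scale c (act \<omega> x y)"
    and pre_lie: "\<lbrakk>x \<in> A; y \<in> A; z \<in> A\<rbrakk> \<Longrightarrow>
      act \<alpha> x (act \<beta> y z) - act (\<alpha> * \<beta>) (act \<alpha> x y) z =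
      act \<beta> y (act \<alpha> x z) - act (\<beta> * \<alpha>) (act \<beta> y x) z"


section \<open>Decorated typed rooted trees\<close>

text \<open>
  Edges point from parent to child. Vertices are natural numbers, which loses no isomorphism
  class of finite trees. The values of \<open>dec\<close> outside \<open>verts\<close> and of \<open>etype\<close> outside \<open>edges\<close>
  are ignored by isomorphisms.
\<close>

record ('x, 'w) dtree =
  verts :: "nat set"
  troot :: nat
  edges :: "(nat \<times> nat) set"
  dec :: "nat \<Rightarrow> 'x"
  etype :: "nat \<times> nat \<Rightarrow> 'w"

definition rooted_tree :: "('x, 'w) dtree \<Rightarrow> bool" where
  "rooted_tree T \<longleftrightarrow>
     finite (verts T) \<and> troot T \<in> verts T \<and> edges T \<subseteq> verts T \<times> verts T \<and>
     (\<forall>u. (u, troot T) \<notin> edges T) \<and>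
     (\<forall>v\<in>verts T - {troot T}. \<exists>!u. (u, v) \<in> edges T) \<and>
     (\<forall>v\<in>verts T. (troot T, v) \<in> (edges T)\<^sup>*)"

definition is_iso :: "(nat \<Rightarrow> nat) \<Rightarrow> ('x, 'w) dtree \<Rightarrow> ('x, 'w) dtree \<Rightarrow> bool" where
  "is_iso f S T \<longleftrightarrow>
     bij_betw f (verts S) (verts T) \<and> f (troot S) = troot T \<and>
     (\<forall>u\<in>verts S. \<forall>v\<in>verts S. (u, v) \<in> edges S \<longleftrightarrow> (f u, f v) \<in> edges T) \<and>
     (\<forall>v\<in>verts S. dec T (f v) = dec S v) \<and>
     (\<forall>(u, v)\<in>edges S. etype T (f u, f v) = etype S (u, v))"

definition tree_iso :: "('x, 'w) dtree \<Rightarrow> ('x, 'w) dtree \<Rightarrow> bool" where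
  "tree_iso S T \<longleftrightarrow> rooted_tree S \<and> rooted_tree T \<and> (\<exists>f. is_iso f S T)"

definition single_vertex :: "'x \<Rightarrow> ('x, 'w) dtree" where
  "single_vertex x = \<lparr>verts = {0}, troot = 0, edges = {}, dec = (\<lambda>_. x), etype = (\<lambda>_. undefined)\<rparr>"

text \<open>
  The vertex set is the disjoint union of those of \<open>S\<close> (tag \<open>Inl\<close>) and \<open>T\<close> (tag \<open>Inr\<close>), coded in
  the natural numbers. The edge of \<open>T\<close> with child \<open>b\<close> lies on the path from \<open>v\<close> to the root iff
  \<open>v\<close> is reachable from \<open>b\<close>. The only edge between the two parts is the new one, of type \<open>\<omega>\<close>.
\<close>

definition graft :: "'w \<Rightarrow> ('x, 'w::ab_semigroup_mult) dtree \<Rightarrow> nat \<Rightarrow> ('x, 'w) dtree \<Rightarrow> ('x, 'w) dtree" where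
  "graft \<omega> S v T = \<lparr>
     verts = sum_encode ` (verts S <+> verts T),
     troot = sum_encode (Inr (troot T)),
     edges = {(sum_encode (Inl a), sum_encode (Inl b)) | a b. (a, b) \<in> edges S} \<union>
             {(sum_encode (Inr a), sum_encode (Inr b)) | a b. (a, b) \<in> edges T} \<union>
             {(sum_encode (Inr v), sum_encode (Inl (troot S)))},
     dec = (\<lambda>n. case sum_decode n of Inl a \<Rightarrow> dec S a | Inr a \<Rightarrow> dec T a),
     etype = (\<lambda>(m, n). case (sum_decode m, sum_decode n) of
          (Inl a, Inl b) \<Rightarrow> etype S (a, b)
        | (Inr a, Inr b) \<Rightarrow>
            if (b, v) \<in> (edges T)\<^sup>* then etype T (a, b) * \<omega> else etype T (a, b)
        | _ \<Rightarrow> \<omega>)\<rparr>"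


subsection \<open>Isomorphism is an equivalence relation\<close>

lemma rooted_tree_single_vertex: "rooted_tree (single_vertex x)"
  by (auto simp: rooted_tree_def single_vertex_def)

lemma is_iso_refl: "is_iso id T T"
  by (auto simp: is_iso_def)

lemma rooted_tree_edgeD:
  assumes "rooted_tree T" "(u, v) \<in> edges T"
  shows "u \<in> verts T" "v \<in> verts T"
  using assms by (auto simp: rooted_tree_def)

lemma rooted_treeD:
  assumes "rooted_tree T"
  shows "finite (verts T)" "troot T \<in> verts T" "(u, troot T) \<notin> edges T"
    "v \<in> verts T \<Longrightarrow> v \<noteq> troot T \<Longrightarrow> \<exists>!u. (u, v) \<in> edges T"
    "v \<in> verts T \<Longrightarrow> (troot T, v) \<in> (edges T)\<^sup>*"
  using assms unfolding rooted_tree_def by blast+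

lemma is_isoD:
  assumes "is_iso f S T"
  shows "bij_betw f (verts S) (verts T)"
    and "f (troot S) = troot T"
    and "\<And>v. v \<in> verts S \<Longrightarrow> f v \<in> verts T"
    and "\<And>u v. \<lbrakk>u \<in> verts S; v \<in> verts S\<rbrakk> \<Longrightarrow> (f u, f v) \<in> edges T \<longleftrightarrow> (u, v) \<in> edges S"
    and "\<And>v. v \<in> verts S \<Longrightarrow> dec T (f v) = dec S v"
    and "\<And>u v. (u, v) \<in> edges S \<Longrightarrow> etype T (f u, f v) = etype S (u, v)"
  using assms unfolding is_iso_def by (blast dest: bij_betwE)+

lemma is_isoI:
  assumes "bij_betw f (verts S) (verts T)"
    and "f (troot S) = troot T"
    and "\<And>u v. \<lbrakk>u \<in> verts S; v \<in> verts S\<rbrakk> \<Longrightarrow> (f u, f v) \<in> edges T \<longleftrightarrow> (u, v) \<in> edges S"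
    and "\<And>v. v \<in> verts S \<Longrightarrow> dec T (f v) = dec S v"
    and "\<And>u v. (u, v) \<in> edges S \<Longrightarrow> etype T (f u, f v) = etype S (u, v)"
  shows "is_iso f S T"
  using assms unfolding is_iso_def by blast

lemma is_iso_trans:
  assumes f: "is_iso f S T" and g: "is_iso g T U" and S: "rooted_tree S"
  shows "is_iso (g \<circ> f) S U"
proof (rule is_isoI)
  show "bij_betw (g \<circ> f) (verts S) (verts U)"
    using is_isoD(1)[OF f] is_isoD(1)[OF g] by (rule bij_betw_trans)
next
  fix u v assume e: "(u, v) \<in> edges S"
  then have "(f u, f v) \<in> edges T"
    using rooted_tree_edgeD[OF S] is_isoD(4)[OF f] by blast
  then show "etype U ((g \<circ> f) u, (g \<circ> f) v) = etype S (u, v)"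
    using e is_isoD(6)[OF f] is_isoD(6)[OF g] by simp
qed (simp_all add: is_isoD(2-5)[OF f] is_isoD(2-5)[OF g])

lemma is_iso_sym:
  assumes f: "is_iso f S T" and S: "rooted_tree S" and T: "rooted_tree T"
  shows "is_iso (inv_into (verts S) f) T S"
proof -
  let ?g = "inv_into (verts S) f"
  note b = is_isoD(1)[OF f]
  have g: "?g v \<in> verts S" "f (?g v) = v" if "v \<in> verts T" for v
    using b that by (metis bij_betw_def inv_into_into, metis bij_betw_def f_inv_into_f)
  have gf: "?g (f v) = v" if "v \<in> verts S" for v
    using b that by (meson bij_betw_def inv_into_f_f)
  show ?thesis
  proof (rule is_isoI)
    show "bij_betw ?g (verts T) (verts S)"
      using b by (rule bij_betw_inv_into)
    have "troot S \<in> verts S" using S by (simp add: rooted_tree_def)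
    then show "?g (troot T) = troot S"
      using gf is_isoD(2)[OF f] by metis
    show e: "(?g u, ?g v) \<in> edges S \<longleftrightarrow> (u, v) \<in> edges T" if "u \<in> verts T" "v \<in> verts T" for u v
      using is_isoD(4)[OF f, of "?g u" "?g v"] g that by simp
    show "dec S (?g v) = dec T v" if "v \<in> verts T" for v
      using is_isoD(5)[OF f, of "?g v"] g that by simp
    show "etype S (?g u, ?g v) = etype T (u, v)" if "(u, v) \<in> edges T" for u v
      using is_isoD(6)[OF f, of "?g u" "?g v"] e g rooted_tree_edgeD[OF T that] that by simp
  qed
qed

lemma part_equivp_tree_iso: "part_equivp tree_iso"
proof (rule part_equivpI)
  show "\<exists>T. tree_iso T T"
    unfolding tree_iso_def
    by (intro exI[of _ "single_vertex undefined"] conjI exI[of _ id]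
        rooted_tree_single_vertex is_iso_refl)
  show "symp tree_iso"
    unfolding symp_def tree_iso_def using is_iso_sym by blast
  show "transp tree_iso"
    unfolding transp_def tree_iso_def using is_iso_trans by blast
qed


subsection \<open>Grafting respects isomorphism\<close>

declare sum_encode_eq [simp]

lemma sum_encode_Plus_iff [simp]: "sum_encode z \<in> sum_encode ` B \<longleftrightarrow> z \<in> B"
  by (simp add: inj_image_mem_iff inj_sum_encode)

lemma Inl_Inr_Plus_iff [simp]: "Inl a \<in> A <+> B \<longleftrightarrow> a \<in> A" "Inr b \<in> A <+> B \<longleftrightarrow> b \<in> B"
  by auto

lemma graft_sel [simp]:
  "verts (graft \<omega> S v T) = sum_encode ` (verts S <+> verts T)"
  "troot (graft \<omega> S v T) = sum_encode (Inr (troot T))"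
  "dec (graft \<omega> S v T) (sum_encode (Inl a)) = dec S a"
  "dec (graft \<omega> S v T) (sum_encode (Inr b)) = dec T b"
  "etype (graft \<omega> S v T) (sum_encode (Inl a), sum_encode (Inl a')) = etype S (a, a')"
  "etype (graft \<omega> S v T) (sum_encode (Inr b), sum_encode (Inr b')) =
     (if (b', v) \<in> (edges T)\<^sup>* then etype T (b, b') * \<omega> else etype T (b, b'))"
  "etype (graft \<omega> S v T) (sum_encode (Inr b), sum_encode (Inl a)) = \<omega>"
  by (simp_all add: graft_def)

lemma edges_graft [simp]:
  "(sum_encode (Inl a), sum_encode (Inl a')) \<in> edges (graft \<omega> S v T) \<longleftrightarrow> (a, a') \<in> edges S"
  "(sum_encode (Inr b), sum_encode (Inr b')) \<in> edges (graft \<omega> S v T) \<longleftrightarrow> (b, b') \<in> edges T"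
  "(sum_encode (Inr b), sum_encode (Inl a)) \<in> edges (graft \<omega> S v T) \<longleftrightarrow> b = v \<and> a = troot S"
  "(sum_encode (Inl a), sum_encode (Inr b)) \<notin> edges (graft \<omega> S v T)"
  by (auto simp: graft_def)

lemma edges_graft_cases:
  assumes "e \<in> edges (graft \<omega> S v T)"
  obtains a a' where "e = (sum_encode (Inl a), sum_encode (Inl a'))" "(a, a') \<in> edges S"
  | b b' where "e = (sum_encode (Inr b), sum_encode (Inr b'))" "(b, b') \<in> edges T"
  | "e = (sum_encode (Inr v), sum_encode (Inl (troot S)))"
  using assms by (auto simp: graft_def)

lemma rooted_tree_graft:
  assumes S: "rooted_tree S" and T: "rooted_tree T" and v: "v \<in> verts T"
  shows "rooted_tree (graft \<omega> S v T)"
proof -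
  let ?G = "graft \<omega> S v T"
  have rT: "(sum_encode (Inr a), sum_encode (Inr b)) \<in> (edges ?G)\<^sup>*" if "(a, b) \<in> (edges T)\<^sup>*" for a b
    using that by induction (auto intro: rtrancl_into_rtrancl)
  have rS: "(sum_encode (Inl a), sum_encode (Inl b)) \<in> (edges ?G)\<^sup>*" if "(a, b) \<in> (edges S)\<^sup>*" for a b
    using that by induction (auto intro: rtrancl_into_rtrancl)
  show ?thesis
    unfolding rooted_tree_def
  proof (intro conjI)
    show "finite (verts ?G)" "troot ?G \<in> verts ?G"
      using S T by (auto simp: rooted_tree_def)
    show "edges ?G \<subseteq> verts ?G \<times> verts ?G"
    proof
      fix e assume "e \<in> edges ?G"
      then show "e \<in> verts ?G \<times> verts ?G"
        by (cases rule: edges_graft_cases)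
          (use v rooted_treeD(2)[OF S] rooted_tree_edgeD[OF S] rooted_tree_edgeD[OF T] in simp_all)
    qed
    show "\<forall>u. (u, troot ?G) \<notin> edges ?G"
      using rooted_treeD(3)[OF T] by (auto elim!: edges_graft_cases)
    show "\<forall>w\<in>verts ?G - {troot ?G}. \<exists>!u. (u, w) \<in> edges ?G"
    proof
      fix w assume w: "w \<in> verts ?G - {troot ?G}"
      then consider (l) a where "a \<in> verts S" "w = sum_encode (Inl a)" "a \<noteq> troot S"
        | (r) "w = sum_encode (Inl (troot S))"
        | (t) b where "b \<in> verts T" "b \<noteq> troot T" "w = sum_encode (Inr b)"
        by auto
      then show "\<exists>!u. (u, w) \<in> edges ?G"
      proof cases
        case l
        then obtain u where "(u, a) \<in> edges S" "\<And>u'. (u', a) \<in> edges S \<longleftrightarrow> u' = u"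
          using rooted_treeD(4)[OF S] by blast
        then show ?thesis
          using l by (intro ex1I[of _ "sum_encode (Inl u)"]) (auto elim!: edges_graft_cases)
      next
        case r
        then show ?thesis
          by (intro ex1I[of _ "sum_encode (Inr v)"])
            (auto elim!: edges_graft_cases simp: rooted_treeD(3)[OF S])
      next
        case t
        then obtain u where "(u, b) \<in> edges T" "\<And>u'. (u', b) \<in> edges T \<longleftrightarrow> u' = u"
          using rooted_treeD(4)[OF T] by blast
        then show ?thesis
          using t by (intro ex1I[of _ "sum_encode (Inr u)"]) (auto elim!: edges_graft_cases)
      qed
    qed
    show "\<forall>w\<in>verts ?G. (troot ?G, w) \<in> (edges ?G)\<^sup>*"
    proof
      fix w assume "w \<in> verts ?G"
      then consider (l) a where "a \<in> verts S" "w = sum_encode (Inl a)"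
        | (t) b where "b \<in> verts T" "w = sum_encode (Inr b)"
        by auto
      then show "(troot ?G, w) \<in> (edges ?G)\<^sup>*"
      proof cases
        case l
        have "(troot ?G, sum_encode (Inr v)) \<in> (edges ?G)\<^sup>*"
          using T v rT by (simp add: rooted_tree_def)
        also have "(sum_encode (Inr v), sum_encode (Inl (troot S))) \<in> (edges ?G)\<^sup>*"
          by (simp add: r_into_rtrancl)
        also have "(sum_encode (Inl (troot S)), w) \<in> (edges ?G)\<^sup>*"
          using S l rS by (simp add: rooted_tree_def)
        finally show ?thesis .
      next
        case t
        then show ?thesis
          using T rT by (simp add: rooted_tree_def)
      qed
    qed
  qed
qed

lemma is_iso_rtrancl_imp:
  assumes f: "is_iso f S T" and S: "rooted_tree S" and ab: "(a, b) \<in> (edges S)\<^sup>*"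
  shows "(f a, f b) \<in> (edges T)\<^sup>*"
  using ab
proof (induction rule: rtrancl_induct)
  case (step y z)
  then have "(f y, f z) \<in> edges T"
    using is_isoD(4)[OF f] rooted_tree_edgeD[OF S] by blast
  with step.IH show ?case by (rule rtrancl_into_rtrancl)
qed simp

lemma is_iso_rtrancl:
  assumes f: "is_iso f S T" and S: "rooted_tree S" and T: "rooted_tree T"
    and ab: "a \<in> verts S" "b \<in> verts S"
  shows "(f a, f b) \<in> (edges T)\<^sup>* \<longleftrightarrow> (a, b) \<in> (edges S)\<^sup>*"
proof
  assume "(f a, f b) \<in> (edges T)\<^sup>*"
  from is_iso_rtrancl_imp[OF is_iso_sym[OF f S T] T this]
  show "(a, b) \<in> (edges S)\<^sup>*"
    using ab is_isoD(1)[OF f] by (simp add: bij_betw_inv_into_left)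
qed (rule is_iso_rtrancl_imp[OF f S])

lemma is_iso_graft:
  assumes f: "is_iso f S S'" and g: "is_iso g T T'"
    and S: "rooted_tree S" and T: "rooted_tree T" and T': "rooted_tree T'" and v: "v \<in> verts T"
  shows "is_iso (sum_encode \<circ> map_sum f g \<circ> sum_decode) (graft \<omega> S v T) (graft \<omega> S' (g v) T')"
    (is "is_iso ?h ?G ?G'")
proof -
  note bf = is_isoD(1)[OF f] and bg = is_isoD(1)[OF g]
  have rt: "troot S \<in> verts S" using S by (simp add: rooted_tree_def)
  have fr: "f a = troot S' \<longleftrightarrow> a = troot S" if "a \<in> verts S" for a
    using that rt bf is_isoD(2)[OF f] by (metis bij_betw_inv_into_left)
  have gv: "g b = g v \<longleftrightarrow> b = v" if "b \<in> verts T" for b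
    using that v bg by (metis bij_betw_inv_into_left)
  show ?thesis
  proof (rule is_isoI)
    show "bij_betw ?h (verts ?G) (verts ?G')"
    proof (rule bij_betw_imageI)
      have "f a = f a' \<longleftrightarrow> a = a'" if "a \<in> verts S" "a' \<in> verts S" for a a'
        using bf that by (meson bij_betw_def inj_on_eq_iff)
      moreover have "g b = g b' \<longleftrightarrow> b = b'" if "b \<in> verts T" "b' \<in> verts T" for b b'
        using bg that by (meson bij_betw_def inj_on_eq_iff)
      ultimately show "inj_on ?h (verts ?G)"
        by (auto intro!: inj_onI)
      have "map_sum f g ` (verts S <+> verts T) = f ` verts S <+> g ` verts T"
        by (simp add: Plus_def image_Un image_image)
      moreover have "f ` verts S = verts S'" "g ` verts T = verts T'"
        using bf bg by (simp_all add: bij_betw_def)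
      moreover have "?h ` verts ?G = sum_encode ` map_sum f g ` (verts S <+> verts T)"
        by (simp add: image_image)
      ultimately show "?h ` verts ?G = verts ?G'"
        by simp
    qed
    show "?h (troot ?G) = troot ?G'"
      by (simp add: is_isoD(2)[OF g])
    show "(?h a, ?h b) \<in> edges ?G' \<longleftrightarrow> (a, b) \<in> edges ?G" if "a \<in> verts ?G" "b \<in> verts ?G" for a b
      using that by (auto simp: fr gv is_isoD(4)[OF f] is_isoD(4)[OF g])
    show "dec ?G' (?h a) = dec ?G a" if "a \<in> verts ?G" for a
      using that by (auto simp: is_isoD(5)[OF f] is_isoD(5)[OF g])
    show "etype ?G' (?h a, ?h b) = etype ?G (a, b)" if "(a, b) \<in> edges ?G" for a b
      using that
    proof (cases rule: edges_graft_cases)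
      case (1 c d)
      then show ?thesis by (simp add: is_isoD(6)[OF f])
    next
      case (2 c d)
      then show ?thesis
        using rooted_tree_edgeD[OF T 2(2)]
        by (simp add: is_isoD(6)[OF g] is_iso_rtrancl[OF g T T' _ v])
    next
      case 3
      then show ?thesis by simp
    qed
  qed
qed


subsection \<open>Isomorphism classes\<close>

quotient_type ('x, 'w) rtree = "('x, 'w) dtree" / partial: tree_iso
  by (rule part_equivp_tree_iso)

lift_definition bullet :: "'x \<Rightarrow> ('x, 'w) rtree" is single_vertex
  unfolding tree_iso_def
  by (intro conjI exI[of _ id] rooted_tree_single_vertex is_iso_refl)

lift_definition decorations :: "('x, 'w) rtree \<Rightarrow> 'x set" is "\<lambda>T. dec T ` verts T"
proof -
  fix S T :: "('x, 'w) dtree" assume "tree_iso S T"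
  then obtain f where f: "is_iso f S T" unfolding tree_iso_def by blast
  then have "verts T = f ` verts S" by (auto simp: is_iso_def bij_betw_def)
  then show "dec S ` verts S = dec T ` verts T"
    by (simp add: image_image is_isoD(5)[OF f] cong: image_cong_simp)
qed

definition trees :: "'x set \<Rightarrow> ('x, 'w) rtree set" where
  "trees X = {T. decorations T \<subseteq> X}"


section \<open>The free module on trees\<close>

definition tree_module :: "'x set \<Rightarrow> (('x, 'w) rtree \<Rightarrow>\<^sub>0 'k::comm_ring_1) set" where
  "tree_module X = {a. Poly_Mapping.keys a \<subseteq> trees X}"

definition tree_scale :: "'k::comm_ring_1 \<Rightarrow> (('x, 'w) rtree \<Rightarrow>\<^sub>0 'k) \<Rightarrow> (('x, 'w) rtree \<Rightarrow>\<^sub>0 'k)" where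
  "tree_scale c = Poly_Mapping.map ((*) c)"

definition tree_gen :: "'x \<Rightarrow> (('x, 'w) rtree \<Rightarrow>\<^sub>0 'k::comm_ring_1)" where
  "tree_gen x = Poly_Mapping.single (bullet x) 1"

lift_definition graft_sum ::
  "'w::ab_semigroup_mult \<Rightarrow> ('x, 'w) rtree \<Rightarrow> ('x, 'w) rtree \<Rightarrow> (('x, 'w) rtree \<Rightarrow>\<^sub>0 'k::comm_ring_1)"
  is "\<lambda>\<omega> S T. \<Sum>v\<in>verts T. Poly_Mapping.single (abs_rtree (graft \<omega> S v T)) 1"
proof -
  fix \<omega> :: 'w and S S' T T' :: "('x, 'w) dtree"
  assume S: "tree_iso S S'" and T: "tree_iso T T'"
  then obtain f g where fg: "is_iso f S S'" "is_iso g T T'"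
    unfolding tree_iso_def by blast
  have bg: "bij_betw g (verts T) (verts T')"
    using fg by (simp add: is_iso_def)
  have eq: "abs_rtree (graft \<omega> S' (g v) T') = abs_rtree (graft \<omega> S v T)" if v: "v \<in> verts T" for v
  proof -
    have "tree_iso (graft \<omega> S v T) (graft \<omega> S' (g v) T')"
      unfolding tree_iso_def
    proof (intro conjI exI)
      show "rooted_tree (graft \<omega> S v T)"
        using S T v by (intro rooted_tree_graft) (auto simp: tree_iso_def)
      show "rooted_tree (graft \<omega> S' (g v) T')"
        using S T v bg by (intro rooted_tree_graft) (auto simp: tree_iso_def bij_betw_def)
      show "is_iso (sum_encode \<circ> map_sum f g \<circ> sum_decode) (graft \<omega> S v T) (graft \<omega> S' (g v) T')"
        using S T v fg by (intro is_iso_graft) (auto simp: tree_iso_def)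
    qed
    then show ?thesis
      by (rule Quotient_rel_abs[OF Quotient_rtree, symmetric])
  qed
  have "(\<Sum>v\<in>verts T'. Poly_Mapping.single (abs_rtree (graft \<omega> S' v T')) (1::'k)) =
        (\<Sum>v\<in>verts T. Poly_Mapping.single (abs_rtree (graft \<omega> S' (g v) T')) 1)"
    by (rule sum.reindex_bij_betw[OF bg, symmetric])
  also have "\<dots> = (\<Sum>v\<in>verts T. Poly_Mapping.single (abs_rtree (graft \<omega> S v T)) 1)"
    by (rule sum.cong) (simp_all add: eq)
  finally show "(\<Sum>v\<in>verts T. Poly_Mapping.single (abs_rtree (graft \<omega> S v T)) (1::'k)) =
    (\<Sum>v\<in>verts T'. Poly_Mapping.single (abs_rtree (graft \<omega> S' v T')) 1)" ..
qed

definition tree_act ::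
  "'w::ab_semigroup_mult \<Rightarrow> (('x, 'w) rtree \<Rightarrow>\<^sub>0 'k::comm_ring_1) \<Rightarrow> (('x, 'w) rtree \<Rightarrow>\<^sub>0 'k)
    \<Rightarrow> (('x, 'w) rtree \<Rightarrow>\<^sub>0 'k)" where
  "tree_act \<omega> a b =
     (\<Sum>S\<in>Poly_Mapping.keys a. \<Sum>T\<in>Poly_Mapping.keys b.
        tree_scale (Poly_Mapping.lookup a S * Poly_Mapping.lookup b T) (graft_sum \<omega> S T))"

end

theory Submission
  imports Defs "HOL-Library.Multiset"
begin

text \<open>
  In a pre-Lie family algebra, symmetric braces
  \<open>{(a\<^sub>1, \<alpha>\<^sub>1), \<dots>, (a\<^sub>n, \<alpha>\<^sub>n); z}\<close> are defined, as in the construction of Guin and Oudom, by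
  \<open>{p, L; z} = p \<rhd> {L; z} - (sum over q in L of {L with q replaced by p \<rhd> q; z})\<close>, where
  \<open>(a, \<alpha>) \<rhd> (b, \<beta>) = (a \<rhd>\<^sub>\<alpha> b, \<alpha> * \<beta>)\<close> and \<open>(a, \<alpha>) \<rhd> z = a \<rhd>\<^sub>\<alpha> z\<close>. No division is needed, so
  this works over every ring, and the pre-Lie family identity makes the brace symmetric.
  A tree with root decoration \<open>x\<close> and branches \<open>T\<^sub>i\<close> on root edges of type \<open>\<omega>\<^sub>i\<close> must be sent to the
  brace of the pairs \<open>(\<phi>(T\<^sub>i), \<omega>\<^sub>i)\<close> at \<open>\<psi>(x)\<close>; the recursion of the brace then says exactly that
  grafting is respected, because a graft happens either at the root or inside one branch, and in
  the latter case it multiplies the type of the root edge of this branch.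
  Uniqueness holds because the one-vertex trees generate: cutting a branch \<open>S\<close> off a tree leaves \<open>U\<close>
  with \<open>S \<rhd>\<^sub>\<omega> U\<close> equal to the tree plus trees of the same size with fewer edges at the root.
\<close>


section \<open>Symmetric braces in a pre-Lie family algebra\<close>

context pre_lie_family_algebra
begin

section \<open>Pairs of an element and a type, acting on the algebra\<close>

definition pact :: "'a \<times> 'w \<Rightarrow> 'a \<Rightarrow> 'a" where
  "pact p z = act (snd p) (fst p) z"

definition pmul :: "'a \<times> 'w \<Rightarrow> 'a \<times> 'w \<Rightarrow> 'a \<times> 'w" where
  "pmul p q = (pact p (fst q), snd p * snd q)"

definition pairs :: "('a \<times> 'w) set" where
  "pairs = {p. fst p \<in> A}"

lemma Pair_in_pairs [simp]: "(a, c) \<in> pairs \<longleftrightarrow> a \<in> A"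
  by (simp add: pairs_def)

lemma fst_in_A: "p \<in> pairs \<Longrightarrow> fst p \<in> A"
  by (simp add: pairs_def)

lemma A_add: "x \<in> A \<Longrightarrow> y \<in> A \<Longrightarrow> x + y \<in> A"
  and A_diff: "x \<in> A \<Longrightarrow> y \<in> A \<Longrightarrow> x - y \<in> A"
  and A_sum: "(\<And>i. i \<in> I \<Longrightarrow> f i \<in> A) \<Longrightarrow> sum f I \<in> A"
  and A_zero: "0 \<in> A"
  and A_scale: "x \<in> A \<Longrightarrow> scale c x \<in> A"
  using carrier by (auto intro: subspace_add subspace_diff subspace_sum subspace_0 subspace_scale)

lemma act_zero_right: "x \<in> A \<Longrightarrow> act \<omega> x 0 = 0"
  using act_add_right[of x 0 0] A_zero by simp

lemma act_zero_left: "x \<in> A \<Longrightarrow> act \<omega> 0 x = 0"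
  using act_add_left[of 0 0 x] A_zero by simp

lemma act_sum_right:
  assumes "x \<in> A" "\<And>i. i \<in> I \<Longrightarrow> f i \<in> A"
  shows "act \<omega> x (sum f I) = (\<Sum>i\<in>I. act \<omega> x (f i))"
  using assms(2)
  by (induction I rule: infinite_finite_induct)
     (simp_all add: act_zero_right act_add_right assms(1) A_sum)

lemma act_sum_left:
  assumes "x \<in> A" "\<And>i. i \<in> I \<Longrightarrow> f i \<in> A"
  shows "act \<omega> (sum f I) x = (\<Sum>i\<in>I. act \<omega> (f i) x)"
  using assms(2)
  by (induction I rule: infinite_finite_induct)
     (simp_all add: act_zero_left act_add_left assms(1) A_sum)

lemma act_diff_right:
  assumes "x \<in> A" "y \<in> A" "y' \<in> A"
  shows "act \<omega> x (y - y') = act \<omega> x y - act \<omega> x y'"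
  using act_add_right[of x "y - y'" y' \<omega>] assms by (simp add: A_diff algebra_simps)

lemma pact_closed: "p \<in> pairs \<Longrightarrow> z \<in> A \<Longrightarrow> pact p z \<in> A"
  by (simp add: pact_def act_closed fst_in_A)

lemma pmul_closed: "p \<in> pairs \<Longrightarrow> q \<in> pairs \<Longrightarrow> pmul p q \<in> pairs"
  by (simp add: pmul_def pact_closed fst_in_A)

lemma pact_diff: "p \<in> pairs \<Longrightarrow> y \<in> A \<Longrightarrow> y' \<in> A \<Longrightarrow> pact p (y - y') = pact p y - pact p y'"
  by (simp add: pact_def act_diff_right fst_in_A)

lemma pact_sum:
  "p \<in> pairs \<Longrightarrow> (\<And>i. i \<in> I \<Longrightarrow> f i \<in> A) \<Longrightarrow> pact p (sum f I) = (\<Sum>i\<in>I. pact p (f i))"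
  by (simp add: pact_def act_sum_right fst_in_A)

text \<open>In terms of pairs the family identity takes the shape of the ordinary left pre-Lie
  identity: \<open>pmul\<close> carries along the product of the types that the outer action
  needs.\<close>

lemma pact_pre_lie:
  assumes "p \<in> pairs" "q \<in> pairs" "z \<in> A"
  shows "pact p (pact q z) - pact (pmul p q) z = pact q (pact p z) - pact (pmul q p) z"
  using pre_lie[of "fst p" "fst q" z "snd p" "snd q"] assms by (simp add: pact_def pmul_def fst_in_A)

section \<open>Braces of lists: closure, additivity and exchange of the first two entries\<close>

function brace_list :: "('a \<times> 'w) list \<Rightarrow> 'a \<Rightarrow> 'a" where
  "brace_list [] z = z"
| "brace_list (p # L) z =
     pact p (brace_list L z) - (\<Sum>i<length L. brace_list (L[i := pmul p (L ! i)]) z)"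
  by pat_completeness auto
text \<open>Replacing an entry keeps the length, so every recursive call is on a list shorter by
  one.\<close>

termination by (relation "measure (\<lambda>(L, z). length L)") auto

lemma list_update_in: "set L \<subseteq> B \<Longrightarrow> x \<in> B \<Longrightarrow> set (L[i := x]) \<subseteq> B"
  by (meson insert_subset order_trans set_update_subset_insert)

lemma nth_in: "set L \<subseteq> B \<Longrightarrow> i < length L \<Longrightarrow> L ! i \<in> B"
  by auto

text \<open>Induction on the length instead of the structure, because the recursion also calls the
  brace on altered tails.\<close>

lemma brace_list_closed:
  assumes "z \<in> A" "set L \<subseteq> pairs"
  shows "brace_list L z \<in> A"
  using assms(2)
proof (induction "length L" arbitrary: L rule: less_induct)
  case less
  show ?case
  proof (cases L)
    case (Cons p K)
    have "brace_list K z \<in> A" using less Cons by auto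
    moreover have "brace_list (K[i := pmul p (K ! i)]) z \<in> A" if "i < length K" for i
      by (rule less.hyps) (use less.prems Cons that in \<open>simp_all add: list_update_in pmul_closed nth_in\<close>)
    ultimately show ?thesis
      using less.prems Cons by (auto intro!: A_diff A_sum pact_closed)
  qed (use assms in simp)
qed

text \<open>The recursion puts the first entry on the left of \<open>pmul\<close> and each later
  entry on its right, so additivity in an entry comes from additivity of the action in both
  arguments. It is what allows the pre-Lie identity to be applied inside an entry.\<close>

lemma brace_list_add:
  assumes z: "z \<in> A" and "set L \<subseteq> pairs" "a \<in> A" "b \<in> A" "i < length L"
  shows "brace_list (L[i := (a + b, c)]) z = brace_list (L[i := (a, c)]) z + brace_list (L[i := (b, c)]) z"
  using assms(2-)
proof (induction "length L" arbitrary: L a b c i rule: less_induct)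
  case less
  then obtain p K where L: "L = p # K" by (cases L) auto
  have K: "set K \<subseteq> pairs" and p: "p \<in> pairs" using less.prems L by auto
  have IH: "brace_list (M[j := (x + y, d)]) z = brace_list (M[j := (x, d)]) z + brace_list (M[j := (y, d)]) z"
    if "set M \<subseteq> pairs" "length M = length K" "x \<in> A" "y \<in> A" "j < length K" for M x y d j
    using less.hyps[of M x y j d] that L by simp
  show ?case
  proof (cases i)
    case 0
    have "brace_list (K[j := pmul (a + b, c) (K ! j)]) z =
       brace_list (K[j := pmul (a, c) (K ! j)]) z + brace_list (K[j := pmul (b, c) (K ! j)]) z"
      if j: "j < length K" for j
    proof -
      have "K ! j \<in> pairs" using K j by (rule nth_in)
      then show ?thesis
        using IH[OF K refl, of "act c a (fst (K!j))" "act c b (fst (K!j))" j "c * snd (K!j)"] less.prems j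
        by (simp add: pmul_def pact_def act_add_left act_closed fst_in_A)
    qed
    moreover have "pact (a + b, c) (brace_list K z) = pact (a, c) (brace_list K z) + pact (b, c) (brace_list K z)"
      using less.prems brace_list_closed[OF z K] by (simp add: pact_def act_add_left)
    ultimately show ?thesis
      using 0 L by (simp add: sum.distrib)
  next
    case (Suc k)
    then have k: "k < length K" using less.prems L by simp
    let ?s = "\<lambda>x j. brace_list (K[k := (x, c), j := pmul p (K[k := (x, c)] ! j)]) z"
    have "?s (a + b) j = ?s a j + ?s b j" if j: "j < length K" for j
    proof (cases "j = k")
      case True
      then show ?thesis
        using IH[OF K refl, of "fst (pmul p (a, c))" "fst (pmul p (b, c))" j "snd p * c"] less.prems p j
        by (simp add: pmul_def pact_def act_add_right act_closed fst_in_A)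
    next
      \<comment> \<open>The two updates are at different positions: exchange them and use the
        induction hypothesis for the list already changed at \<open>j\<close>.\<close>
      case False
      have q: "K ! j \<in> pairs" using K j by (rule nth_in)
      show ?thesis
        using IH[of "K[j := pmul p (K ! j)]" a b k c] less.prems p k False q K
        by (simp add: list_update_swap[of k j] list_update_in pmul_closed)
    qed
    moreover have "pact p (brace_list (K[k := (a + b, c)]) z) =
        pact p (brace_list (K[k := (a, c)]) z) + pact p (brace_list (K[k := (b, c)]) z)"
      using IH[OF K refl _ _ k, of a b c] less.prems p K
      by (simp add: pact_def act_add_right brace_list_closed[OF z] list_update_in fst_in_A)
    ultimately show ?thesis
      using Suc L by (simp add: sum.distrib)
  qed
qed

text \<open>After two steps of the recursion, \<open>p\<close> and \<open>q\<close> act on the brace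
  of \<open>L\<close>, on one common entry of \<open>L\<close>, or on two separate places. The first
  two kinds of terms are symmetric by the pre-Lie family identity, the last kind because separate
  updates commute.\<close>

lemma brace_list_swap:
  assumes z: "z \<in> A" and L: "set L \<subseteq> pairs" and p: "p \<in> pairs" and q: "q \<in> pairs"
  shows "brace_list (p # q # L) z = brace_list (q # p # L) z"
proof -
  let ?B = "\<lambda>L. brace_list L z" and ?n = "length L"
  have BL: "?B M \<in> A" if "set M \<subseteq> pairs" for M using brace_list_closed[OF z that] .
  have n: "L ! i \<in> pairs" if "i < ?n" for i using that L by (rule nth_in[rotated])
  \<comment> \<open>The terms in which \<open>p\<close> and \<open>q\<close> are absorbed by two
    different entries of \<open>L\<close>.\<close>
  define D where "D p q = (\<Sum>i<?n. \<Sum>j\<in>{..<?n} - {i}. ?B (L[i := pmul p (L ! i), j := pmul q (L ! j)]))" for p q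
  have D: "D p q = D q p"
  proof -
    have e: "D p q = (\<Sum>i<?n. \<Sum>j<?n. if j = i then 0 else ?B (L[i := pmul p (L ! i), j := pmul q (L ! j)]))" for p q
      unfolding D_def by (intro sum.cong refl sum.mono_neutral_cong_left) auto
    show ?thesis
      unfolding e[of p q] e[of q p]
      by (subst sum.swap) (intro sum.cong refl, simp add: list_update_swap)
  qed
  \<comment> \<open>Unfolding both recursion steps: position 0 of \<open>q # L\<close> yields the
    terms with \<open>pmul p q\<close>, the other positions yield the mixed terms and
    \<open>D p q\<close>.\<close>
  have exp: "?B (p # q # L) = (pact p (pact q (?B L)) - pact (pmul p q) (?B L))
     - ((\<Sum>i<?n. pact p (?B (L[i := pmul q (L ! i)]))) + (\<Sum>i<?n. pact q (?B (L[i := pmul p (L ! i)]))))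
     + (\<Sum>i<?n. ?B (L[i := pmul (pmul p q) (L ! i)]) + ?B (L[i := pmul q (pmul p (L ! i))])) + D p q"
    if p: "p \<in> pairs" and q: "q \<in> pairs" for p q
  proof -
    have "pact p (?B (q # L)) = pact p (pact q (?B L)) - (\<Sum>i<?n. pact p (?B (L[i := pmul q (L ! i)])))"
    proof -
      have u: "?B (L[i := pmul q (L ! i)]) \<in> A" if "i < ?n" for i
        using q n[OF that] L by (intro BL) (simp add: list_update_in pmul_closed)
      show ?thesis
        using pact_diff[OF p pact_closed[OF q BL[OF L]] A_sum[of "{..<?n}"], OF u]
          pact_sum[OF p, of "{..<?n}", OF u] by simp
    qed
    moreover have "(\<Sum>i<?n. ?B (q # L[i := pmul p (L ! i)])) =
       (\<Sum>i<?n. pact q (?B (L[i := pmul p (L ! i)]))) - (\<Sum>i<?n. ?B (L[i := pmul q (pmul p (L ! i))])) - D p q"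
    proof -
      have "?B (q # L[i := pmul p (L ! i)]) = pact q (?B (L[i := pmul p (L ! i)])) -
         (?B (L[i := pmul q (pmul p (L ! i))])
         + (\<Sum>j\<in>{..<?n} - {i}. ?B (L[i := pmul p (L ! i), j := pmul q (L ! j)])))" if "i < ?n" for i
        using that by (auto simp: sum.remove[of "{..<?n}" i] intro!: sum.cong)
      then have "(\<Sum>i<?n. ?B (q # L[i := pmul p (L ! i)])) =
          (\<Sum>i<?n. pact q (?B (L[i := pmul p (L ! i)])) - (?B (L[i := pmul q (pmul p (L ! i))])
             + (\<Sum>j\<in>{..<?n} - {i}. ?B (L[i := pmul p (L ! i), j := pmul q (L ! j)]))))"
        by (intro sum.cong refl) (simp only: lessThan_iff)
      then show ?thesis by (simp only: D_def sum_subtractf sum.distrib diff_diff_eq)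
    qed
    ultimately show ?thesis
      by (simp add: sum.lessThan_Suc_shift sum.distrib del: sum.lessThan_Suc)
  qed
  txt \<open>By additivity in the entry \<open>i\<close> this is the pre-Lie family identity for \<open>p\<close>, \<open>q\<close> and \<open>L ! i\<close>.\<close>
  have "?B (L[i := pmul (pmul p q) (L ! i)]) + ?B (L[i := pmul q (pmul p (L ! i))]) =
        ?B (L[i := pmul (pmul q p) (L ! i)]) + ?B (L[i := pmul p (pmul q (L ! i))])" if i: "i < ?n" for i
  proof -
    obtain l d where l: "L ! i = (l, d)" "l \<in> A" using n[OF i] by (cases "L ! i") auto
    have e: "pact (pmul p q) l + pact q (pact p l) = pact (pmul q p) l + pact p (pact q l)"
      using pact_pre_lie[OF p q l(2)] by (simp add: algebra_simps)
    have c: "pact p l \<in> A" "pact q l \<in> A" "pmul p q \<in> pairs" "pmul q p \<in> pairs"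
      using p q l by (auto intro: pact_closed simp: pmul_closed)
    have *: "pmul (pmul p q) (L ! i) = (pact (pmul p q) l, snd p * snd q * d)"
      "pmul (pmul q p) (L ! i) = (pact (pmul q p) l, snd p * snd q * d)"
      "pmul q (pmul p (L ! i)) = (pact q (pact p l), snd p * snd q * d)"
      "pmul p (pmul q (L ! i)) = (pact p (pact q l), snd p * snd q * d)"
      using l by (simp_all add: pmul_def ac_simps)
    show ?thesis unfolding *
      by (subst (1 2) brace_list_add[symmetric]) (use p q c l L i z e pact_closed in auto)
  qed
  then show ?thesis
    unfolding exp[OF p q] exp[OF q p] D
    using pact_pre_lie[OF p q BL[OF L]] by (simp add: add.commute)
qed

section \<open>Braces of multisets\<close>

definition brace :: "('a \<times> 'w) multiset \<Rightarrow> 'a \<Rightarrow> 'a" where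
  "brace M z = brace_list (SOME L. mset L = M) z"

text \<open>This makes the arbitrary choice of a list in \<open>brace\<close> harmless. For equal
  heads the recursion depends only on the multiset of the tail; for different heads both lists can
  be rearranged, keeping the heads, so that they differ by an exchange of the first two
  entries.\<close>

lemma brace_list_perm:
  assumes z: "z \<in> A" and "set L \<subseteq> pairs" "mset L = mset L'"
  shows "brace_list L z = brace_list L' z"
  using assms(2,3)
proof (induction "length L" arbitrary: L L' rule: less_induct)
  case less
  \<comment> \<open>For shorter lists the induction hypothesis already identifies the list chosen by
    \<open>SOME\<close> with any other, so \<open>brace\<close> may be used for them.\<close>
  have IH: "brace_list M z = brace (mset M) z" if "set M \<subseteq> pairs" "length M < length L" for M
  proof -
    have "mset (SOME M'. mset M' = mset M) = mset M" by (rule someI) simp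
    then show ?thesis unfolding brace_def by (intro less.hyps[OF that(2) that(1)]) (rule sym)
  qed
  have head: "brace_list (p # K) z = brace_list (p # K') z"
    if "mset K = mset K'" "set K \<subseteq> pairs" "p \<in> pairs" "length K < length L" for p K K'
  proof -
    \<comment> \<open>The sum over positions becomes a sum over the multiset of entries, which
      forgets the order.\<close>
    have *: "brace_list (p # M) z = pact p (brace (mset M) z) -
       (\<Sum>q\<in>#mset M. brace (add_mset (pmul p q) (mset M - {#q#})) z)"
      if M: "set M \<subseteq> pairs" "length M < length L" for M
    proof -
      have "brace_list (M[i := pmul p (M ! i)]) z = brace (add_mset (pmul p (M ! i)) (mset M - {#M ! i#})) z"
        if "i < length M" for i
        using IH[of "M[i := pmul p (M ! i)]"] M that \<open>p \<in> pairs\<close>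
        by (simp add: mset_update list_update_in pmul_closed nth_in)
      then have "(\<Sum>i<length M. brace_list (M[i := pmul p (M ! i)]) z) =
         (\<Sum>i<length M. brace (add_mset (pmul p (M ! i)) (mset M - {#M ! i#})) z)" by simp
      also have "\<dots> = sum_list (map (\<lambda>q. brace (add_mset (pmul p q) (mset M - {#q#})) z) M)"
        by (simp add: sum_list_sum_nth atLeast0LessThan)
      also have "\<dots> = (\<Sum>q\<in>#mset M. brace (add_mset (pmul p q) (mset M - {#q#})) z)"
        by (simp flip: sum_mset_sum_list)
      finally show ?thesis using IH M by simp
    qed
    have "set K' \<subseteq> pairs" "length K' < length L"
      using that mset_eq_setD[OF that(1)] mset_eq_length[OF that(1)] by simp_all
    from *[OF this] *[OF that(2,4)] show ?thesis
      by (simp only: that(1))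
  qed
  show ?case
  proof (cases L)
    case Nil
    then show ?thesis using less.prems by simp
  next
    case (Cons p K)
    then obtain p' K' where L': "L' = p' # K'" using less.prems by (cases L') auto
    have in_pairs: "p \<in> pairs" "p' \<in> pairs" "set K \<subseteq> pairs" "set K' \<subseteq> pairs"
      using less.prems Cons L' by (metis insert_subset list.simps(15) mset_eq_setD)+
    have len: "length K < length L" "length K' < length L"
      using mset_eq_length[OF less.prems(2)] Cons L' by simp_all
    show ?thesis
    proof (cases "p = p'")
      case True
      then show ?thesis using head[of K K' p] less.prems Cons L' in_pairs len by simp
    next
      case False
      have "add_mset p (mset K) = add_mset p' (mset K')"
        using less.prems(2) Cons L' by simp
      \<comment> \<open>Each tail contains the head of the other list; \<open>N\<close> is what the
        two tails have in common beyond that.\<close>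
      then obtain N where N: "mset K = add_mset p' N" "mset K' = add_mset p N"
        using False unfolding add_eq_conv_ex by blast
      obtain J where "mset J = N" using ex_mset by blast
      then have J: "mset K = mset (p' # J)" "mset K' = mset (p # J)"
        using N by simp_all
      have J_in: "set J \<subseteq> pairs"
        using mset_eq_setD[OF J(1)] in_pairs(3) by simp
      have "brace_list L z = brace_list (p # p' # J) z"
        unfolding Cons by (rule head[OF J(1) in_pairs(3,1) len(1)])
      also have "\<dots> = brace_list (p' # p # J) z"
        by (rule brace_list_swap[OF z J_in in_pairs(1,2)])
      also have "\<dots> = brace_list L' z"
        unfolding L' by (rule head[OF J(2) in_pairs(4,2) len(2), symmetric])
      finally show ?thesis .
    qed
  qed
qed

lemma brace_mset:
  assumes "z \<in> A" "set L \<subseteq> pairs"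
  shows "brace (mset L) z = brace_list L z"
proof -
  have "mset (SOME M'. mset M' = mset L) = mset L" by (rule someI) simp
  then show ?thesis unfolding brace_def by (metis brace_list_perm[OF assms])
qed

lemma brace_empty: "brace {#} z = z"
  by (simp add: brace_def)

lemma brace_closed:
  assumes "z \<in> A" "set_mset M \<subseteq> pairs"
  shows "brace M z \<in> A"
  using assms by (metis brace_list_closed brace_mset ex_mset set_mset_mset)

text \<open>The recursion in symmetric form: any entry may be singled out, and the sum counts the
  other entries with multiplicity.\<close>

lemma brace_add_mset:
  assumes z: "z \<in> A" and M: "set_mset M \<subseteq> pairs" and p: "p \<in> pairs"
  shows "brace (add_mset p M) z =
    pact p (brace M z) - (\<Sum>q\<in>#M. brace (add_mset (pmul p q) (M - {#q#})) z)"
proof -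
  obtain L where L: "M = mset L" by (metis ex_mset)
  then have L_in: "set L \<subseteq> pairs" using M by simp
  have "(\<Sum>i<length L. brace_list (L[i := pmul p (L ! i)]) z) =
     (\<Sum>i<length L. brace (add_mset (pmul p (L ! i)) (mset L - {#L ! i#})) z)"
  proof (rule sum.cong[OF refl])
    fix i assume "i \<in> {..<length L}"
    then show "brace_list (L[i := pmul p (L ! i)]) z = brace (add_mset (pmul p (L ! i)) (mset L - {#L ! i#})) z"
      using brace_mset[OF z, of "L[i := pmul p (L ! i)]"] L_in p
      by (simp add: mset_update list_update_in pmul_closed nth_in)
  qed
  also have "\<dots> = sum_list (map (\<lambda>q. brace (add_mset (pmul p q) (mset L - {#q#})) z) L)"
    by (simp add: sum_list_sum_nth atLeast0LessThan)
  also have "\<dots> = (\<Sum>q\<in>#M. brace (add_mset (pmul p q) (M - {#q#})) z)"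
    unfolding L by (simp flip: sum_mset_sum_list)
  finally show ?thesis
    using brace_mset[OF z, of "p # L"] brace_mset[OF z L_in] L_in p L by simp
qed

lemma brace_add:
  assumes z: "z \<in> A" and M: "set_mset M \<subseteq> pairs" and "a \<in> A" "b \<in> A"
  shows "brace (add_mset (a + b, c) M) z = brace (add_mset (a, c) M) z + brace (add_mset (b, c) M) z"
proof -
  obtain L where L: "M = mset L" by (metis ex_mset)
  then have L_in: "set L \<subseteq> pairs" using M by simp
  have "brace_list ((x, c) # L) z = brace (add_mset (x, c) M) z" if "x \<in> A" for x
    using brace_mset[OF z, of "(x, c) # L"] L L_in that by simp
  then show ?thesis
    using brace_list_add[OF z, of "(a, c) # L" a b 0 c] assms(3,4) L_in A_add by (simp del: brace_list.simps)
qed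

text \<open>Serves to move a sum over grafting vertices into the single entry that the grafting
  changes.\<close>

lemma brace_sum:
  assumes z: "z \<in> A" and M: "set_mset M \<subseteq> pairs" and "\<And>i. i \<in> I \<Longrightarrow> f i \<in> A"
  shows "brace (add_mset (sum f I, c) M) z = (\<Sum>i\<in>I. brace (add_mset (f i, c) M) z)"
proof -
  have 0: "brace (add_mset (0, c) M) z = 0"
    using brace_add[OF z M A_zero A_zero, of c] by simp
  show ?thesis
    using assms(3) by (induction I rule: infinite_finite_induct) (simp_all add: 0 brace_add[OF z M] A_sum)
qed

end


section \<open>Evaluation of trees\<close>

definition children :: "('x, 'w) dtree \<Rightarrow> nat \<Rightarrow> nat set" where
  "children T v = {c. (v, c) \<in> edges T}"

definition descendants :: "('x, 'w) dtree \<Rightarrow> nat \<Rightarrow> nat set" where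
  "descendants T v = {u. (v, u) \<in> (edges T)\<^sup>*}"

lemma children_iff [simp]: "c \<in> children T v \<longleftrightarrow> (v, c) \<in> edges T"
  by (simp add: children_def)

lemma descendants_iff [simp]: "u \<in> descendants T v \<longleftrightarrow> (v, u) \<in> (edges T)\<^sup>*"
  by (simp add: descendants_def)

lemma finite_edges: "rooted_tree T \<Longrightarrow> finite (edges T)"
  unfolding rooted_tree_def by (meson finite_SigmaI finite_subset)

lemma children_subset: "rooted_tree T \<Longrightarrow> children T v \<subseteq> verts T"
  by (auto dest: rooted_tree_edgeD)

lemma finite_children: "rooted_tree T \<Longrightarrow> finite (children T v)"
  by (rule finite_subset[OF children_subset rooted_treeD(1)])

lemma descendants_subset:
  assumes "rooted_tree T" "v \<in> verts T"
  shows "descendants T v \<subseteq> verts T"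
proof
  fix u assume "u \<in> descendants T v"
  then have "(v, u) \<in> (edges T)\<^sup>*" by simp
  then show "u \<in> verts T"
    by (induction rule: rtrancl_induct) (use assms rooted_tree_edgeD in blast)+
qed

lemma finite_descendants: "rooted_tree T \<Longrightarrow> v \<in> verts T \<Longrightarrow> finite (descendants T v)"
  by (rule finite_subset[OF descendants_subset rooted_treeD(1)])

lemma descendants_troot: "rooted_tree T \<Longrightarrow> descendants T (troot T) = verts T"
  using descendants_subset[OF _ rooted_treeD(2)] rooted_treeD(5) by (fastforce simp: descendants_def)

lemma unique_parent:
  assumes T: "rooted_tree T" and e: "(u, v) \<in> edges T" "(u', v) \<in> edges T"
  shows "u = u'"
proof -
  have "v \<noteq> troot T" using rooted_treeD(3)[OF T] e by blast
  then show ?thesis using rooted_treeD(4)[OF T rooted_tree_edgeD(2)[OF T e(1)]] e by blast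
qed

text \<open>A cycle through \<open>z\<close> enters \<open>z\<close> from its only parent, so it
  passes through the parent too. Along the path from the root this moves the cycle up to the root,
  which no edge enters.\<close>

lemma acyclic_edges:
  assumes T: "rooted_tree T"
  shows "acyclic (edges T)"
proof (rule acyclicI, rule allI, rule notI)
  fix v assume cyc: "(v, v) \<in> (edges T)\<^sup>+"
  then obtain u where "(u, v) \<in> edges T" by (meson tranclD2)
  then have "(troot T, v) \<in> (edges T)\<^sup>*"
    by (rule rooted_treeD(5)[OF T rooted_tree_edgeD(2)[OF T]])
  then have "(v, v) \<notin> (edges T)\<^sup>+"
  proof (induction rule: rtrancl_induct)
    case base
    then show ?case using rooted_treeD(3)[OF T] by (meson tranclD2)
  next
    case (step y z)
    show ?case
    proof
      assume "(z, z) \<in> (edges T)\<^sup>+"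
      then obtain y' where "(z, y') \<in> (edges T)\<^sup>*" "(y', z) \<in> edges T" by (meson tranclD2)
      with unique_parent[OF T step(2)] have "(z, y) \<in> (edges T)\<^sup>*" by blast
      with step(2) have "(y, y) \<in> (edges T)\<^sup>+" by (rule rtrancl_into_trancl2)
      with step.IH show False by blast
    qed
  qed
  with cyc show False by blast
qed

text \<open>Makes recursion and induction from the leaves towards the root available.\<close>

lemma wf_edges: "rooted_tree T \<Longrightarrow> wf ((edges T)\<inverse>)"
  by (intro finite_acyclic_wf_converse finite_edges acyclic_edges)

lemma edge_not_rtrancl:
  assumes "rooted_tree T" "(u, v) \<in> edges T"
  shows "(v, u) \<notin> (edges T)\<^sup>*"
  using acyclic_edges[OF assms(1)] assms(2) unfolding acyclic_def by (meson rtrancl_into_trancl2)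

text \<open>Parents are unique, so two ancestors of a common vertex are comparable. Siblings are
  not: a path from one to the other would reach it through their parent \<open>w\<close> and close a
  cycle.\<close>

lemma descendants_disjoint:
  assumes T: "rooted_tree T" and c: "(w, c) \<in> edges T" "(w, c') \<in> edges T" and ne: "c \<noteq> c'"
  shows "descendants T c \<inter> descendants T c' = {}"
proof -
  have no: "(d, d') \<notin> (edges T)\<^sup>*" if d: "(w, d) \<in> edges T" "(w, d') \<in> edges T" and "d \<noteq> d'" for d d'
  proof
    assume "(d, d') \<in> (edges T)\<^sup>*"
    with \<open>d \<noteq> d'\<close> obtain u where "(d, u) \<in> (edges T)\<^sup>*" "(u, d') \<in> edges T" by (meson rtranclE)
    with unique_parent[OF T d(2)] edge_not_rtrancl[OF T d(1)] show False by blast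
  qed
  have sv: "single_valued ((edges T)\<inverse>)"
    using unique_parent[OF T] by (auto intro: single_valuedI)
  show ?thesis
  proof (rule ccontr)
    assume "\<not> ?thesis"
    then obtain v where "(c, v) \<in> (edges T)\<^sup>*" "(c', v) \<in> (edges T)\<^sup>*" by auto
    then have "(v, c) \<in> ((edges T)\<inverse>)\<^sup>*" "(v, c') \<in> ((edges T)\<inverse>)\<^sup>*" by (simp_all add: rtrancl_converse)
    from single_valued_confluent[OF sv this] show False
      using no[OF c ne] no[OF c(2,1)] ne by (auto simp: rtrancl_converse)
  qed
qed

lemma descendants_unfold: "descendants T w = insert w (\<Union>c\<in>children T w. descendants T c)"
proof (intro set_eqI iffI)
  fix u assume "u \<in> descendants T w"
  then have "(w, u) \<in> (edges T)\<^sup>*" by simp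
  then show "u \<in> insert w (\<Union>c\<in>children T w. descendants T c)"
    by (cases rule: converse_rtranclE) auto
next
  fix u assume "u \<in> insert w (\<Union>c\<in>children T w. descendants T c)"
  then show "u \<in> descendants T w"
    by (elim insertE UN_E) (simp_all add: converse_rtrancl_into_rtrancl)
qed

lemma children_graft:
  "children (graft \<omega> S v T) (sum_encode (Inl a)) = (sum_encode \<circ> Inl) ` children S a"
  "children (graft \<omega> S v T) (sum_encode (Inr w)) =
     (sum_encode \<circ> Inr) ` children T w \<union> (if w = v then {sum_encode (Inl (troot S))} else {})"
  by (auto elim!: edges_graft_cases)

lemma dec_graft: "dec (graft \<omega> S v T) ` verts (graft \<omega> S v T) = dec S ` verts S \<union> dec T ` verts T"
  by (simp add: Plus_def image_Un image_image)

section \<open>Evaluating trees by iterated braces\<close>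

context pre_lie_family_algebra
begin

text \<open>The recursion runs along the converse edges and is total on records; its equation
  \<open>value_at_unfold\<close> is for rooted trees. The branches form a multiset because trees are
  non-planar and equal branches must be counted repeatedly.\<close>

definition value_at :: "('x \<Rightarrow> 'a) \<Rightarrow> ('x, 'w) dtree \<Rightarrow> nat \<Rightarrow> 'a" where
  "value_at \<psi> T = wfrec ((edges T)\<inverse>) (\<lambda>f v.
     brace (image_mset (\<lambda>c. (f c, etype T (v, c))) (mset_set (children T v))) (\<psi> (dec T v)))"

lemma value_at_unfold:
  assumes "rooted_tree T"
  shows "value_at \<psi> T v =
    brace (image_mset (\<lambda>c. (value_at \<psi> T c, etype T (v, c))) (mset_set (children T v))) (\<psi> (dec T v))"
  unfolding value_at_def wfrec[OF wf_edges[OF assms], of _ v]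
  by (intro arg_cong2[of _ _ _ _ brace] refl image_mset_cong)
    (auto simp: cut_apply finite_children[OF assms])

lemma value_at_closed:
  assumes T: "rooted_tree T" and \<psi>: "\<psi> \<in> X \<rightarrow> A" and X: "dec T ` verts T \<subseteq> X"
    and v: "v \<in> verts T"
  shows "value_at \<psi> T v \<in> A"
  using v
proof (induction v rule: wf_induct_rule[OF wf_edges[OF T]])
  case (1 v)
  then have "value_at \<psi> T c \<in> A" if "(v, c) \<in> edges T" for c
    using that rooted_tree_edgeD[OF T that] by simp
  then show ?case
    unfolding value_at_unfold[OF T, of _ v] using \<psi> X 1(2)
    by (intro brace_closed) (auto simp: finite_children[OF T])
qed

text \<open>The value at \<open>w\<close> depends only on what lies below, so children, decorations
  and types are compared on a set closed under children. Injectivity preserves the multiplicities of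
  branches. Isomorphisms and the unchanged parts of a graft are special cases.\<close>

lemma value_at_embed:
  assumes S: "rooted_tree S" and T: "rooted_tree T" and w: "w \<in> W"
    and W: "\<And>u. u \<in> W \<Longrightarrow> children S u \<subseteq> W" and inj: "inj_on f W"
    and ch: "\<And>u. u \<in> W \<Longrightarrow> children T (f u) = f ` children S u"
    and dec: "\<And>u. u \<in> W \<Longrightarrow> dec T (f u) = dec S u"
    and et: "\<And>u c. u \<in> W \<Longrightarrow> (u, c) \<in> edges S \<Longrightarrow> etype T (f u, f c) = etype S (u, c)"
  shows "value_at \<psi> T (f w) = value_at \<psi> S w"
  using w
proof (induction w rule: wf_induct_rule[OF wf_edges[OF S]])
  case (1 w)
  have "mset_set (children T (f w)) = image_mset f (mset_set (children S w))"
    unfolding ch[OF 1(2)] using inj W[OF 1(2)] by (metis image_mset_mset_set inj_on_subset)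
  moreover have "value_at \<psi> T (f c) = value_at \<psi> S c" if "(w, c) \<in> edges S" for c
    using 1 that W[OF 1(2)] by auto
  ultimately show ?case
    unfolding value_at_unfold[OF S, of _ w] value_at_unfold[OF T, of _ "f w"]
    using 1(2) dec et
    by (auto intro!: arg_cong2[of _ _ _ _ brace] image_mset_cong simp: finite_children[OF S] multiset.map_comp)
qed

lemma value_at_iso:
  assumes f: "is_iso f S T" and S: "rooted_tree S" and T: "rooted_tree T" and v: "v \<in> verts S"
  shows "value_at \<psi> T (f v) = value_at \<psi> S v"
proof (rule value_at_embed[OF S T v])
  show "inj_on f (verts S)" using is_isoD(1)[OF f] by (simp add: bij_betw_def)
  show "children T (f u) = f ` children S u" if u: "u \<in> verts S" for u
  proof
    show "f ` children S u \<subseteq> children T (f u)"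
      using is_isoD(4)[OF f u] rooted_tree_edgeD[OF S] by auto
    show "children T (f u) \<subseteq> f ` children S u"
    proof
      fix d assume d: "d \<in> children T (f u)"
      then have "d \<in> f ` verts S"
        using rooted_tree_edgeD[OF T] is_isoD(1)[OF f] by (auto simp: bij_betw_def)
      then show "d \<in> f ` children S u"
        using d is_isoD(4)[OF f u] by auto
    qed
  qed
qed (use children_subset[OF S] is_isoD[OF f] in auto)

lemma value_at_graft_left:
  assumes S: "rooted_tree S" and T: "rooted_tree T" and v: "v \<in> verts T" and a: "a \<in> verts S"
  shows "value_at \<psi> (graft \<omega> S v T) (sum_encode (Inl a)) = value_at \<psi> S a"
  using value_at_embed[OF S rooted_tree_graft[OF S T v, of \<omega>] a, where f = "sum_encode \<circ> Inl" and \<psi> = \<psi> ]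
    children_subset[OF S] by (simp add: children_graft inj_on_def)

text \<open>Grafting at \<open>v\<close> adds a child only to \<open>v\<close> and changes the type
  of an edge of \<open>T\<close> only if \<open>v\<close> is reachable from its child. Neither
  happens below \<open>w\<close>.\<close>

lemma value_at_graft_off_path:
  assumes S: "rooted_tree S" and T: "rooted_tree T" and v: "v \<in> verts T" and w: "(w, v) \<notin> (edges T)\<^sup>*"
  shows "value_at \<psi> (graft \<omega> S v T) (sum_encode (Inr w)) = value_at \<psi> T w"
proof -
  have *: "(c, v) \<notin> (edges T)\<^sup>*" if "(u, v) \<notin> (edges T)\<^sup>*" "(u, c) \<in> edges T" for u c
    using that by (meson converse_rtrancl_into_rtrancl)
  define W where "W = {u. (u, v) \<notin> (edges T)\<^sup>*}"
  have W: "v \<notin> W" "w \<in> W" "u \<in> W \<Longrightarrow> (u, c) \<in> edges T \<Longrightarrow> c \<in> W" for u c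
    using w * by (simp_all add: W_def)
  have "value_at \<psi> (graft \<omega> S v T) ((sum_encode \<circ> Inr) w) = value_at \<psi> T w"
  proof (rule value_at_embed[OF T rooted_tree_graft[OF S T v] W(2)])
    fix u assume u: "u \<in> W"
    then have "u \<noteq> v" using W(1) by blast
    then show "children (graft \<omega> S v T) ((sum_encode \<circ> Inr) u) = (sum_encode \<circ> Inr) ` children T u"
      by (simp add: children_graft)
    show "children T u \<subseteq> W" using W(3)[OF u] by auto
    fix c assume "(u, c) \<in> edges T"
    with W(3)[OF u] have "(c, v) \<notin> (edges T)\<^sup>*" by (simp add: W_def)
    then show "etype (graft \<omega> S v T) ((sum_encode \<circ> Inr) u, (sum_encode \<circ> Inr) c) = etype T (u, c)"
      by simp
  qed (simp_all add: inj_on_def)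
  then show ?thesis by simp
qed

text \<open>Induction from the leaves, grafting only at the descendants of \<open>w\<close>. These
  are \<open>w\<close> itself and the descendants of each child, and their contributions are exactly
  the terms of the brace recursion \<open>brace_add_mset\<close> for the pair formed by the value of
  \<open>S\<close> and \<omega>.\<close>

lemma sum_value_at_graft:
  assumes S: "rooted_tree S" and T: "rooted_tree T" and \<psi>: "\<psi> \<in> X \<rightarrow> A"
    and X: "dec S ` verts S \<subseteq> X" "dec T ` verts T \<subseteq> X" and w: "w \<in> verts T"
  shows "(\<Sum>v\<in>descendants T w. value_at \<psi> (graft \<omega> S v T) (sum_encode (Inr w))) =
    act \<omega> (value_at \<psi> S (troot S)) (value_at \<psi> T w)"
  using w
proof (induction w rule: wf_induct_rule[OF wf_edges[OF T]])
  case (1 w)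
  let ?F = "\<lambda>v w. value_at \<psi> (graft \<omega> S v T) (sum_encode (Inr w))"
  define C where "C = children T w"
  define g where "g c = (value_at \<psi> T c, etype T (w, c))" for c
  define z where "z = \<psi> (dec T w)"
  define s where "s = value_at \<psi> S (troot S)"
  have finC: "finite C" unfolding C_def by (rule finite_children[OF T])
  have C: "(w, c) \<in> edges T" "c \<in> verts T" "(c, w) \<notin> (edges T)\<^sup>*" if "c \<in> C" for c
    using that rooted_tree_edgeD[OF T] edge_not_rtrancl[OF T] by (auto simp: C_def)
  have z: "z \<in> A" using 1(2) \<psi> X by (auto simp: z_def)
  have s: "s \<in> A" unfolding s_def by (rule value_at_closed[OF S \<psi> X(1) rooted_treeD(2)[OF S]])
  have g: "g c \<in> pairs" if "c \<in> C" for c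
    using value_at_closed[OF T \<psi> X(2) C(2)[OF that]] by (simp add: g_def)
  then have gM: "set_mset (image_mset g (mset_set C')) \<subseteq> pairs" if "C' \<subseteq> C" for C'
    using that finite_subset[OF that finC] by auto
  have Fv: "?F v c \<in> A" if "v \<in> verts T" "c \<in> verts T" for v c
    using that X by (intro value_at_closed[OF rooted_tree_graft[OF S T that(1)] \<psi>])
      (simp add: dec_graft del: graft_sel, simp)
  have enc: "inj_on (sum_encode \<circ> Inr) B" for B :: "nat set"
    by (simp add: inj_on_def)
  \<comment> \<open>Grafting at \<open>w\<close> adds one entry to the brace and keeps the others,
    since no child of \<open>w\<close> leads back to \<open>w\<close>.\<close>
  have Fw: "?F w w = brace (add_mset (s, \<omega>) (image_mset g (mset_set C))) z"
  proof -
    have "mset_set (children (graft \<omega> S w T) (sum_encode (Inr w))) =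
        add_mset (sum_encode (Inl (troot S))) (image_mset (sum_encode \<circ> Inr) (mset_set C))"
      unfolding image_mset_mset_set[OF enc] children_graft using finC
      by (simp add: C_def) (subst mset_set.insert, auto)
    then show ?thesis
      unfolding value_at_unfold[OF rooted_tree_graft[OF S T 1(2)], of _ _ "sum_encode (Inr w)"]
      using C value_at_graft_off_path[OF S T 1(2)] value_at_graft_left[OF S T 1(2) rooted_treeD(2)[OF S]]
      by (auto intro!: arg_cong2[of _ _ _ _ brace] image_mset_cong
          simp: s_def z_def g_def finC multiset.map_comp)
  qed
  \<comment> \<open>Grafting below the child \<open>c\<close> affects only the entry of
    \<open>c\<close>: its value changes, and its type gains the factor \<omega> because the edge
    from \<open>w\<close> to \<open>c\<close> lies on the path from \<open>v\<close> to the
    root.\<close>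
  have F: "?F v w = brace (add_mset (?F v c, snd (g c) * \<omega>) (image_mset g (mset_set (C - {c})))) z"
    if c: "c \<in> C" and v: "(c, v) \<in> (edges T)\<^sup>*" for c v
  proof -
    have v_in: "v \<in> verts T" using descendants_subset[OF T C(2)[OF c]] v by auto
    have "v \<noteq> w" using C(3)[OF c] v by blast
    have off: "(d, v) \<notin> (edges T)\<^sup>*" if "d \<in> C" "d \<noteq> c" for d
      using descendants_disjoint[OF T C(1)[OF c] C(1)[OF that(1)]] that(2) v by auto
    have "mset_set (children (graft \<omega> S v T) (sum_encode (Inr w))) =
        image_mset (sum_encode \<circ> Inr) (mset_set (insert c (C - {c})))"
      unfolding image_mset_mset_set[OF enc] children_graft using \<open>v \<noteq> w\<close> c
      by (simp add: C_def insert_absorb)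
    also have "\<dots> = image_mset (sum_encode \<circ> Inr) (add_mset c (mset_set (C - {c})))"
      using finC by (subst mset_set.insert) auto
    finally show ?thesis
      unfolding value_at_unfold[OF rooted_tree_graft[OF S T v_in], of _ _ "sum_encode (Inr w)"]
      using off v value_at_graft_off_path[OF S T v_in]
      by (auto intro!: arg_cong2[of _ _ _ _ brace] image_mset_cong
          simp: z_def g_def finC multiset.map_comp)
  qed
  \<comment> \<open>Additivity in the entry of \<open>c\<close> collects the sum over
    \<open>v\<close> there, and the induction hypothesis turns it into the action of
    \<open>s\<close> on the value at \<open>c\<close>.\<close>
  have Fc: "(\<Sum>v\<in>descendants T c. ?F v w) =
      brace (add_mset (pmul (s, \<omega>) (g c)) (image_mset g (mset_set C) - {#g c#})) z" if c: "c \<in> C" for c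
  proof -
    have "(\<Sum>v\<in>descendants T c. ?F v w) =
        (\<Sum>v\<in>descendants T c. brace (add_mset (?F v c, snd (g c) * \<omega>) (image_mset g (mset_set (C - {c})))) z)"
      using F[OF c] by (intro sum.cong) simp_all
    also have "\<dots> = brace (add_mset (\<Sum>v\<in>descendants T c. ?F v c, snd (g c) * \<omega>) (image_mset g (mset_set (C - {c})))) z"
      using descendants_subset[OF T C(2)[OF c]] C(2)[OF c]
      by (intro brace_sum[symmetric] z gM Fv) auto
    also have "(\<Sum>v\<in>descendants T c. ?F v c) = act \<omega> s (fst (g c))"
      using 1(1)[of c] C[OF c] by (simp add: s_def g_def)
    \<comment> \<open>Different children may give equal pairs, so leaving out the vertex
      \<open>c\<close> removes just one copy of \<open>g c\<close>.\<close>
    also have "image_mset g (mset_set (C - {c})) = image_mset g (mset_set C) - {#g c#}"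
      using finC c by (simp add: mset_set_Diff image_mset_Diff)
    finally show ?thesis by (simp add: pmul_def pact_def mult.commute)
  qed
  have "(\<Sum>v\<in>descendants T w. ?F v w) = ?F w w + (\<Sum>v\<in>(\<Union>c\<in>C. descendants T c). ?F v w)"
    unfolding descendants_unfold[of T w] C_def[symmetric]
    using C finC finite_descendants[OF T] by (intro sum.insert) auto
  also have "(\<Sum>v\<in>(\<Union>c\<in>C. descendants T c). ?F v w) = (\<Sum>c\<in>C. \<Sum>v\<in>descendants T c. ?F v w)"
    using C finC finite_descendants[OF T] descendants_disjoint[OF T, of w] by (intro sum.UNION_disjoint) auto
  also have "\<dots> = (\<Sum>c\<in>C. brace (add_mset (pmul (s, \<omega>) (g c)) (image_mset g (mset_set C) - {#g c#})) z)"
    by (intro sum.cong refl Fc)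
  also have "\<dots> = (\<Sum>q\<in>#image_mset g (mset_set C).
      brace (add_mset (pmul (s, \<omega>) q) (image_mset g (mset_set C) - {#q#})) z)"
    by (simp add: sum_unfold_sum_mset multiset.map_comp comp_def)
  finally show ?case
    unfolding Fw using brace_add_mset[OF z gM[OF order.refl], of "(s, \<omega>)"] s
    unfolding value_at_unfold[OF T, of _ w]
    by (simp add: pact_def s_def g_def[abs_def] C_def z_def)
qed

end


section \<open>The pre-Lie family identity for grafting\<close>

text \<open>
  A copy of \<open>module\<close>: constants added to \<open>module\<close> itself would be shadowed by the ones of its
  global interpretation for real vector spaces.
\<close>

locale linear_extension = module scale
  for scale :: "'k::comm_ring_1 \<Rightarrow> 'a::ab_group_add \<Rightarrow> 'a"
begin

definition lin :: "('t \<Rightarrow> 'a) \<Rightarrow> ('t \<Rightarrow>\<^sub>0 'k) \<Rightarrow> 'a" where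
  "lin f a = (\<Sum>t\<in>Poly_Mapping.keys a. scale (Poly_Mapping.lookup a t) (f t))"

lemma lin_superset:
  assumes "finite B" "Poly_Mapping.keys a \<subseteq> B"
  shows "lin f a = (\<Sum>t\<in>B. scale (Poly_Mapping.lookup a t) (f t))"
  unfolding lin_def using assms by (intro sum.mono_neutral_left) (auto simp: in_keys_iff)

lemma lin_add: "lin f (a + b) = lin f a + lin f b"
proof -
  let ?B = "Poly_Mapping.keys a \<union> Poly_Mapping.keys b"
  have "Poly_Mapping.keys (a + b) \<subseteq> ?B" by (rule Poly_Mapping.keys_add)
  then show ?thesis
    using lin_superset[of ?B "a + b" f] lin_superset[of ?B a f] lin_superset[of ?B b f]
    by (simp add: lookup_add scale_left_distrib sum.distrib)
qed

lemma lin_zero [simp]: "lin f 0 = 0"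
  by (simp add: lin_def)

lemma lin_sum: "lin f (sum g I) = (\<Sum>i\<in>I. lin f (g i))"
  by (induction I rule: infinite_finite_induct) (simp_all add: lin_add)

lemma lin_single [simp]: "lin f (Poly_Mapping.single t c) = scale c (f t)"
  by (simp add: lin_def)

lemma lin_add_fun: "lin (\<lambda>t. f t + g t) a = lin f a + lin g a"
  by (simp add: lin_def scale_right_distrib sum.distrib)

lemma lin_scale_fun: "lin (\<lambda>t. scale c (f t)) a = scale c (lin f a)"
  by (simp add: lin_def scale_sum_right mult.commute)

lemma lin_in_subspace:
  "subspace A \<Longrightarrow> (\<And>t. t \<in> Poly_Mapping.keys a \<Longrightarrow> f t \<in> A) \<Longrightarrow> lin f a \<in> A"
  unfolding lin_def by (intro subspace_sum subspace_scale)

end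

section \<open>The free module on trees and its bilinear operations\<close>

lemma lookup_tree_scale [simp]:
  "Poly_Mapping.lookup (tree_scale c a) t = c * Poly_Mapping.lookup a t"
  by (simp add: tree_scale_def map.rep_eq when_def)

interpretation tree: linear_extension tree_scale
  by unfold_locales (auto intro!: poly_mapping_eqI simp: lookup_add algebra_simps)

lemma tree_scale_single [simp]: "tree_scale c (Poly_Mapping.single t d) = Poly_Mapping.single t (c * d)"
  by (auto intro!: poly_mapping_eqI simp: lookup_single when_def)

lemma keys_tree_scale: "Poly_Mapping.keys (tree_scale c a) \<subseteq> Poly_Mapping.keys a"
  by (auto simp: in_keys_iff)

lemma (in linear_extension) lin_scale: "lin f (tree_scale c a) = scale c (lin f a)"
  using lin_superset[OF finite_keys keys_tree_scale, of f c a]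
  by (simp add: lin_def scale_sum_right)

lemma poly_mapping_sum_single:
  "a = (\<Sum>t\<in>Poly_Mapping.keys a. tree_scale (Poly_Mapping.lookup a t) (Poly_Mapping.single t 1))"
  by (rule poly_mapping_eqI) (auto simp: lookup_sum lookup_single when_def in_keys_iff)

lemma tree_module_subspace:
  fixes X :: "'x set"
  shows "tree.subspace (tree_module X :: (('x, 'w) rtree \<Rightarrow>\<^sub>0 'k::comm_ring_1) set)"
  unfolding tree_module_def
proof (rule tree.subspaceI, safe)
  fix a b :: "('x, 'w) rtree \<Rightarrow>\<^sub>0 'k" and t
  assume "Poly_Mapping.keys a \<subseteq> trees X" "Poly_Mapping.keys b \<subseteq> trees X" "t \<in> Poly_Mapping.keys (a + b)"
  then show "t \<in> trees X" using Poly_Mapping.keys_add[of a b] by blast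
next
  fix a :: "('x, 'w) rtree \<Rightarrow>\<^sub>0 'k" and t c
  assume "Poly_Mapping.keys a \<subseteq> trees X" "t \<in> Poly_Mapping.keys (tree_scale c a)"
  then show "t \<in> trees X" using keys_tree_scale[of c a] by blast
qed simp

text \<open>Bilinearity of \<open>tree_act\<close> then follows from linearity of \<open>lin\<close>
  in its function and in its vector.\<close>

lemma tree_act_eq_lin: "tree_act \<omega> a b = tree.lin (\<lambda>S. tree.lin (graft_sum \<omega> S) b) a"
  by (simp add: tree_act_def tree.lin_def tree.scale_sum_right)

lemma tree_act_add_left: "tree_act \<omega> (a + a') b = tree_act \<omega> a b + tree_act \<omega> a' b"
  and tree_act_add_right: "tree_act \<omega> a (b + b') = tree_act \<omega> a b + tree_act \<omega> a b'"
  and tree_act_scale_left: "tree_act \<omega> (tree_scale c a) b = tree_scale c (tree_act \<omega> a b)"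
  and tree_act_scale_right: "tree_act \<omega> a (tree_scale c b) = tree_scale c (tree_act \<omega> a b)"
  by (simp_all add: tree_act_eq_lin tree.lin_add tree.lin_scale tree.lin_add_fun tree.lin_scale_fun)

lemma tree_act_sum_left: "tree_act \<omega> (sum f I) b = (\<Sum>i\<in>I. tree_act \<omega> (f i) b)"
  by (simp add: tree_act_eq_lin tree.lin_sum)

lemma tree_act_zero_right: "tree_act \<omega> a 0 = 0"
  using tree_act_add_right[of \<omega> a 0 0] by simp

lemma tree_act_sum_right: "tree_act \<omega> a (sum f I) = (\<Sum>i\<in>I. tree_act \<omega> a (f i))"
  by (induction I rule: infinite_finite_induct) (simp_all add: tree_act_add_right tree_act_zero_right)

section \<open>Representatives of isomorphism classes, and iterated grafts\<close>

lemma tree_iso_refl: "rooted_tree T \<Longrightarrow> tree_iso T T"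
  unfolding tree_iso_def using is_iso_refl by blast

text \<open>The domain of the partial quotient consists of rooted trees, so every chosen
  representative is rooted.\<close>

lemma rtree_cases:
  obtains T where "rooted_tree T" "t = abs_rtree T"
proof
  show "rooted_tree (rep_rtree t)"
    using Quotient_rep_reflp[OF Quotient_rtree, of t] by (simp add: tree_iso_def)
  show "t = abs_rtree (rep_rtree t)"
    by (simp add: Quotient_abs_rep[OF Quotient_rtree])
qed

lemma abs_rtree_eqI: "rooted_tree S \<Longrightarrow> rooted_tree T \<Longrightarrow> is_iso f S T \<Longrightarrow> abs_rtree S = abs_rtree T"
  using Quotient_rel_abs[OF Quotient_rtree, of S T] unfolding tree_iso_def by blast

lemma tree_act_single:
  assumes "rooted_tree S" "rooted_tree T"
  shows "tree_act \<omega> (Poly_Mapping.single (abs_rtree S) 1) (Poly_Mapping.single (abs_rtree T) 1) =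
    (\<Sum>v\<in>verts T. Poly_Mapping.single (abs_rtree (graft \<omega> S v T)) 1)"
  using assms by (simp add: tree_act_eq_lin graft_sum.abs_eq tree_iso_refl)

lemma decorations_abs: "rooted_tree T \<Longrightarrow> decorations (abs_rtree T) = dec T ` verts T"
  by (simp add: decorations.abs_eq tree_iso_refl)

lemma bullet_in_trees: "x \<in> X \<Longrightarrow> bullet x \<in> trees X"
  by (simp add: trees_def bullet_def decorations_abs rooted_tree_single_vertex) (simp add: single_vertex_def)

lemma tree_act_closed:
  assumes "a \<in> tree_module X" "b \<in> tree_module X"
  shows "tree_act \<omega> a b \<in> tree_module X"
  unfolding tree_act_eq_lin
proof (intro tree.lin_in_subspace[OF tree_module_subspace])
  fix s t assume "s \<in> Poly_Mapping.keys a" "t \<in> Poly_Mapping.keys b"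
  then have st: "s \<in> trees X" "t \<in> trees X" using assms by (auto simp: tree_module_def)
  obtain S T where S: "rooted_tree S" "s = abs_rtree S" and T: "rooted_tree T" "t = abs_rtree T"
    by (meson rtree_cases)
  have "Poly_Mapping.single (abs_rtree (graft \<omega> S v T)) 1 \<in> tree_module X" if "v \<in> verts T" for v
    using st S T that decorations_abs[OF rooted_tree_graft[OF S(1) T(1) that, of \<omega>]]
    by (auto simp: tree_module_def trees_def decorations_abs dec_graft simp del: graft_sel)
  then show "graft_sum \<omega> s t \<in> tree_module X"
    unfolding S(2) T(2) graft_sum.abs_eq[OF tree_iso_refl[OF S(1)] tree_iso_refl[OF T(1)]]
    by (rule tree.subspace_sum[OF tree_module_subspace])
qed

text \<open>Edge types in a graft are decided by reachability, so computing an iterated graft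
  requires the reachability relation of the inner one.\<close>

lemma rtrancl_graft:
  assumes S: "rooted_tree S"
  shows "(sum_encode (Inl a), sum_encode (Inl a')) \<in> (edges (graft \<omega> S v T))\<^sup>* \<longleftrightarrow> (a, a') \<in> (edges S)\<^sup>*" (is ?ll)
    and "(sum_encode (Inr b), sum_encode (Inr b')) \<in> (edges (graft \<omega> S v T))\<^sup>* \<longleftrightarrow> (b, b') \<in> (edges T)\<^sup>*" (is ?rr)
    and "(sum_encode (Inr b), sum_encode (Inl a)) \<in> (edges (graft \<omega> S v T))\<^sup>* \<longleftrightarrow>
      (b, v) \<in> (edges T)\<^sup>* \<and> (troot S, a) \<in> (edges S)\<^sup>*" (is ?rl)
    and "(sum_encode (Inl a), sum_encode (Inr b)) \<notin> (edges (graft \<omega> S v T))\<^sup>*" (is ?lr)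
proof -
  let ?E = "edges (graft \<omega> S v T)"
  have rT: "(sum_encode (Inr a), sum_encode (Inr b)) \<in> ?E\<^sup>*" if "(a, b) \<in> (edges T)\<^sup>*" for a b
    using that by induction (auto intro: rtrancl_into_rtrancl)
  have rS: "(sum_encode (Inl a), sum_encode (Inl b)) \<in> ?E\<^sup>*" if "(a, b) \<in> (edges S)\<^sup>*" for a b
    using that by induction (auto intro: rtrancl_into_rtrancl)
  have L: "\<exists>a'. y = sum_encode (Inl a') \<and> (a, a') \<in> (edges S)\<^sup>*" if "(sum_encode (Inl a), y) \<in> ?E\<^sup>*" for y
    using that by induction (auto elim!: edges_graft_cases intro: rtrancl_into_rtrancl)
  have R: "(\<exists>b'. y = sum_encode (Inr b') \<and> (b, b') \<in> (edges T)\<^sup>*) \<or>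
      (\<exists>a. y = sum_encode (Inl a) \<and> (b, v) \<in> (edges T)\<^sup>* \<and> (troot S, a) \<in> (edges S)\<^sup>*)"
    if "(sum_encode (Inr b), y) \<in> ?E\<^sup>*" for y
    using that by induction (auto elim!: edges_graft_cases intro: rtrancl_into_rtrancl)
  show ?ll ?lr using L rS by fastforce+
  show ?rr using R rT by fastforce
  have "(sum_encode (Inr b), sum_encode (Inl a)) \<in> ?E\<^sup>*" if "(b, v) \<in> (edges T)\<^sup>*" "(troot S, a) \<in> (edges S)\<^sup>*"
  proof -
    have "(sum_encode (Inr v), sum_encode (Inl (troot S))) \<in> ?E" by simp
    then show ?thesis using rT[OF that(1)] rS[OF that(2)] by (meson rtrancl_into_rtrancl rtrancl_trans)
  qed
  then show ?rl using R by fastforce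
qed

text \<open>The isomorphism reassociates the nested disjoint unions. The edge joining
  \<open>T\<close> to \<open>U\<close> has type \<beta> and is then multiplied by \<alpha>, which is
  why \<alpha> * \<beta> appears on the right.\<close>

lemma graft_graft_left:
  fixes S T U :: "('x, 'w::ab_semigroup_mult) dtree"
  assumes S: "rooted_tree S" and T: "rooted_tree T" and U: "rooted_tree U"
    and t: "t \<in> verts T" and u: "u \<in> verts U"
  shows "abs_rtree (graft \<alpha> S (sum_encode (Inl t)) (graft \<beta> T u U)) =
    abs_rtree (graft (\<alpha> * \<beta>) (graft \<alpha> S t T) u U)"
proof -
  let ?G = "graft \<alpha> S (sum_encode (Inl t)) (graft \<beta> T u U)" and ?H = "graft (\<alpha> * \<beta>) (graft \<alpha> S t T) u U"
  define f where "f n = (case sum_decode n of Inl s \<Rightarrow> sum_encode (Inl (sum_encode (Inl s)))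
    | Inr m \<Rightarrow> (case sum_decode m of Inl t \<Rightarrow> sum_encode (Inl (sum_encode (Inr t))) | Inr u \<Rightarrow> sum_encode (Inr u)))" for n
  define g where "g n = (case sum_decode n of Inr u \<Rightarrow> sum_encode (Inr (sum_encode (Inr u)))
    | Inl m \<Rightarrow> (case sum_decode m of Inl s \<Rightarrow> sum_encode (Inl s) | Inr t \<Rightarrow> sum_encode (Inr (sum_encode (Inl t)))))" for n
  have f [simp]: "f (sum_encode (Inl n)) = sum_encode (Inl (sum_encode (Inl n)))"
    "f (sum_encode (Inr (sum_encode (Inl n)))) = sum_encode (Inl (sum_encode (Inr n)))"
    "f (sum_encode (Inr (sum_encode (Inr n)))) = sum_encode (Inr n)" for n
    by (simp_all add: f_def)
  have g [simp]: "g (sum_encode (Inr n)) = sum_encode (Inr (sum_encode (Inr n)))"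
    "g (sum_encode (Inl (sum_encode (Inl n)))) = sum_encode (Inl n)"
    "g (sum_encode (Inl (sum_encode (Inr n)))) = sum_encode (Inr (sum_encode (Inl n)))" for n
    by (simp_all add: g_def)
  have "is_iso f ?G ?H"
  proof (rule is_isoI)
    show "bij_betw f (verts ?G) (verts ?H)"
      by (rule bij_betw_byWitness[where f' = g]) auto
    show "(f a, f b) \<in> edges ?H \<longleftrightarrow> (a, b) \<in> edges ?G" if "a \<in> verts ?G" "b \<in> verts ?G" for a b
      using that by auto
    show "dec ?H (f a) = dec ?G a" if "a \<in> verts ?G" for a
      using that by auto
    show "etype ?H (f a, f b) = etype ?G (a, b)" if "(a, b) \<in> edges ?G" for a b
      \<comment> \<open>Since \<open>t\<close> is reachable from the root of \<open>T\<close>, the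
        joining edge and the edges of \<open>U\<close> on the path from \<open>u\<close> to the root
        also lie on the path from \<open>t\<close> to the root.\<close>
      using that rooted_treeD(5)[OF T t]
      by (auto elim!: edges_graft_cases simp: rtrancl_graft[OF T] rtrancl_graft[OF S] ac_simps)
  qed simp
  then show ?thesis
    using S T U t u by (intro abs_rtree_eqI rooted_tree_graft) auto
qed

text \<open>The two grafts are independent: an edge of \<open>U\<close> lying on both paths receives
  both factors, in either order.\<close>

lemma graft_graft_right:
  fixes S T U :: "('x, 'w::ab_semigroup_mult) dtree"
  assumes S: "rooted_tree S" and T: "rooted_tree T" and U: "rooted_tree U"
    and u: "u \<in> verts U" "u' \<in> verts U"
  shows "abs_rtree (graft \<alpha> S (sum_encode (Inr u')) (graft \<beta> T u U)) =
    abs_rtree (graft \<beta> T (sum_encode (Inr u)) (graft \<alpha> S u' U))"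
proof -
  let ?G = "graft \<alpha> S (sum_encode (Inr u')) (graft \<beta> T u U)" and ?H = "graft \<beta> T (sum_encode (Inr u)) (graft \<alpha> S u' U)"
  define f where "f n = (case sum_decode n of Inl s \<Rightarrow> sum_encode (Inr (sum_encode (Inl s)))
    | Inr m \<Rightarrow> (case sum_decode m of Inl t \<Rightarrow> sum_encode (Inl t) | Inr u \<Rightarrow> n))" for n
  have f [simp]: "f (sum_encode (Inl n)) = sum_encode (Inr (sum_encode (Inl n)))"
    "f (sum_encode (Inr (sum_encode (Inl n)))) = sum_encode (Inl n)"
    "f (sum_encode (Inr (sum_encode (Inr n)))) = sum_encode (Inr (sum_encode (Inr n)))" for n
    by (simp_all add: f_def)
  have "is_iso f ?G ?H"
  proof (rule is_isoI)
    show "bij_betw f (verts ?G) (verts ?H)"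
      \<comment> \<open>The same formula regroups the vertices in both directions, so
        \<open>f\<close> is its own inverse.\<close>
      by (rule bij_betw_byWitness[where f' = f]) auto
    show "(f a, f b) \<in> edges ?H \<longleftrightarrow> (a, b) \<in> edges ?G" if "a \<in> verts ?G" "b \<in> verts ?G" for a b
      using that by auto
    show "dec ?H (f a) = dec ?G a" if "a \<in> verts ?G" for a
      using that by auto
    show "etype ?H (f a, f b) = etype ?G (a, b)" if "(a, b) \<in> edges ?G" for a b
      using that
      by (auto elim!: edges_graft_cases simp: rtrancl_graft[OF T] rtrancl_graft[OF S] ac_simps)
  qed simp
  then show ?thesis
    using S T U u by (intro abs_rtree_eqI rooted_tree_graft) auto
qed

section \<open>The pre-Lie family identity on trees and its multilinear extension\<close>

lemma sum_verts_graft: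
  assumes "rooted_tree S" "rooted_tree T"
  shows "sum h (verts (graft \<omega> S v T)) =
    (\<Sum>a\<in>verts S. h (sum_encode (Inl a))) + (\<Sum>b\<in>verts T. h (sum_encode (Inr b)))"
  using assms
  by (simp add: sum.reindex[OF inj_sum_encode] sum.Plus rooted_treeD(1) comp_def)

text \<open>The vertices of the inner graft come from \<open>T\<close> or from \<open>U\<close>.
  Those from \<open>T\<close> give the subtracted term, by \<open>graft_graft_left\<close>; what
  remains is a sum over pairs of vertices of \<open>U\<close>, symmetric by
  \<open>graft_graft_right\<close>.\<close>

lemma tree_act_pre_lie_single:
  fixes S T U :: "('x, 'w::ab_semigroup_mult) dtree"
  assumes S: "rooted_tree S" and T: "rooted_tree T" and U: "rooted_tree U"
  defines "s \<equiv> Poly_Mapping.single (abs_rtree S) (1::'k::comm_ring_1)"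
    and "t \<equiv> Poly_Mapping.single (abs_rtree T) 1" and "z \<equiv> Poly_Mapping.single (abs_rtree U) 1"
  shows "tree_act \<alpha> s (tree_act \<beta> t z) - tree_act (\<alpha> * \<beta>) (tree_act \<alpha> s t) z =
    tree_act \<beta> t (tree_act \<alpha> s z) - tree_act (\<beta> * \<alpha>) (tree_act \<beta> t s) z"
proof -
  have *: "tree_act \<alpha> (Poly_Mapping.single (abs_rtree S) (1::'k))
       (tree_act \<beta> (Poly_Mapping.single (abs_rtree T) 1) z) -
     tree_act (\<alpha> * \<beta>) (tree_act \<alpha> (Poly_Mapping.single (abs_rtree S) 1) (Poly_Mapping.single (abs_rtree T) 1)) z =
    (\<Sum>u\<in>verts U. \<Sum>u'\<in>verts U.
       Poly_Mapping.single (abs_rtree (graft \<alpha> S (sum_encode (Inr u')) (graft \<beta> T u U))) 1)"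
    if S: "rooted_tree S" and T: "rooted_tree T" for S T :: "('x, 'w) dtree" and \<alpha> \<beta>
  proof -
    have "tree_act \<alpha> (Poly_Mapping.single (abs_rtree S) (1::'k)) (tree_act \<beta> (Poly_Mapping.single (abs_rtree T) 1) z) =
      (\<Sum>u\<in>verts U. \<Sum>w\<in>verts (graft \<beta> T u U).
         Poly_Mapping.single (abs_rtree (graft \<alpha> S w (graft \<beta> T u U))) 1)"
      using S T U by (simp add: z_def tree_act_single tree_act_sum_right rooted_tree_graft del: graft_sel)
    also have "\<dots> = (\<Sum>u\<in>verts U. (\<Sum>t\<in>verts T.
         Poly_Mapping.single (abs_rtree (graft (\<alpha> * \<beta>) (graft \<alpha> S t T) u U)) 1) + (\<Sum>u'\<in>verts U.
       Poly_Mapping.single (abs_rtree (graft \<alpha> S (sum_encode (Inr u')) (graft \<beta> T u U))) 1))"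
      using S T U by (intro sum.cong refl) (simp add: sum_verts_graft graft_graft_left del: graft_sel)
    also have "\<dots> = (\<Sum>u\<in>verts U. \<Sum>t\<in>verts T.
         Poly_Mapping.single (abs_rtree (graft (\<alpha> * \<beta>) (graft \<alpha> S t T) u U)) 1) + (\<Sum>u\<in>verts U. \<Sum>u'\<in>verts U.
       Poly_Mapping.single (abs_rtree (graft \<alpha> S (sum_encode (Inr u')) (graft \<beta> T u U))) 1)"
      by (rule sum.distrib)
    also have "(\<Sum>u\<in>verts U. \<Sum>t\<in>verts T.
         Poly_Mapping.single (abs_rtree (graft (\<alpha> * \<beta>) (graft \<alpha> S t T) u U)) (1::'k)) =
      tree_act (\<alpha> * \<beta>) (tree_act \<alpha> (Poly_Mapping.single (abs_rtree S) 1) (Poly_Mapping.single (abs_rtree T) 1)) z"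
      using S T U by (subst sum.swap) (simp add: z_def tree_act_single tree_act_sum_left rooted_tree_graft)
    finally show ?thesis by simp
  qed
  show ?thesis
    unfolding s_def t_def *[OF S T] *[OF T S] using S T U
    by (subst sum.swap) (intro sum.cong refl, simp add: graft_graft_right)
qed

lemma tree_induct_single:
  assumes "\<And>T. rooted_tree T \<Longrightarrow> P (Poly_Mapping.single (abs_rtree T) (1::'k::comm_ring_1))"
    and "P 0" and "\<And>a b. P a \<Longrightarrow> P b \<Longrightarrow> P (a + b)" and "\<And>c a. P a \<Longrightarrow> P (tree_scale c a)"
  shows "P a"
proof -
  have "P (Poly_Mapping.single t (1::'k))" for t
    using assms(1) by (metis rtree_cases)
  then have "P (sum (\<lambda>t. tree_scale (Poly_Mapping.lookup a t) (Poly_Mapping.single t 1)) K)" for K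
    by (induction K rule: infinite_finite_induct) (simp_all add: assms(2-4) del: tree_scale_single)
  then show ?thesis using poly_mapping_sum_single[of a] by metis
qed

lemma tree_act_pre_lie:
  fixes a b c :: "('x, 'w::ab_semigroup_mult) rtree \<Rightarrow>\<^sub>0 'k::comm_ring_1"
  shows "tree_act \<alpha> a (tree_act \<beta> b c) - tree_act (\<alpha> * \<beta>) (tree_act \<alpha> a b) c =
    tree_act \<beta> b (tree_act \<alpha> a c) - tree_act (\<beta> * \<alpha>) (tree_act \<beta> b a) c" (is "?P a b c")
proof -
  note lins = tree_act_add_left tree_act_add_right tree_act_scale_left tree_act_scale_right
  have zero: "tree_act \<omega> 0 d = 0" for \<omega> and d :: "('x, 'w) rtree \<Rightarrow>\<^sub>0 'k"
    by (simp add: tree_act_eq_lin)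
  have add: "x + x' - (y + y') = z + z' - (w + w')" if "x - y = z - w" "x' - y' = z' - w'"
    for x y z w x' y' z' w' :: "('x, 'w) rtree \<Rightarrow>\<^sub>0 'k"
    using that by (simp add: add_diff_add)
  have scale: "tree_scale r x - tree_scale r y = tree_scale r z - tree_scale r w" if "x - y = z - w"
    for r and x y z w :: "('x, 'w) rtree \<Rightarrow>\<^sub>0 'k"
    using that by (simp flip: tree.scale_right_diff_distrib)
  have lin: "?P 0 b c" "?P a 0 c" "?P a b 0"
    "?P a b c \<Longrightarrow> ?P a' b c \<Longrightarrow> ?P (a + a') b c" "?P a b c \<Longrightarrow> ?P (tree_scale r a) b c"
    "?P a b c \<Longrightarrow> ?P a b' c \<Longrightarrow> ?P a (b + b') c" "?P a b c \<Longrightarrow> ?P a (tree_scale r b) c"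
    "?P a b c \<Longrightarrow> ?P a b c' \<Longrightarrow> ?P a b (c + c')" "?P a b c \<Longrightarrow> ?P a b (tree_scale r c)"
    for a a' b b' c c' :: "('x, 'w) rtree \<Rightarrow>\<^sub>0 'k" and r
    by (simp add: zero tree_act_zero_right, simp add: zero tree_act_zero_right, simp add: zero tree_act_zero_right)
      (unfold lins, (erule (1) add | erule scale)+)
  \<comment> \<open>Arguments pass from single trees to arbitrary elements one at a time: first
    \<open>c\<close>, then \<open>b\<close>, then \<open>a\<close>.\<close>
  have "?P (Poly_Mapping.single (abs_rtree S) 1) (Poly_Mapping.single (abs_rtree T) 1) c"
    if S: "rooted_tree S" and T: "rooted_tree T" for S T :: "('x, 'w) dtree"
    by (rule tree_induct_single[of _ c]) (fact tree_act_pre_lie_single[OF S T] lin)+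
  then have "?P (Poly_Mapping.single (abs_rtree S) 1) b c" if S: "rooted_tree S" for S :: "('x, 'w) dtree"
    using S by (intro tree_induct_single[of "\<lambda>b. ?P (Poly_Mapping.single (abs_rtree S) 1) b c" b] lin)
  then show ?thesis
    by (intro tree_induct_single[of "\<lambda>a. ?P a b c" a] lin)
qed

lemma pre_lie_family_algebra_tree_module:
  "pre_lie_family_algebra tree_scale
    (tree_module X :: (('x, 'w::ab_semigroup_mult) rtree \<Rightarrow>\<^sub>0 'k::comm_ring_1) set) tree_act"
  by unfold_locales
    (simp_all add: tree_module_subspace tree_act_closed tree_act_add_left tree_act_add_right
      tree_act_scale_left tree_act_scale_right tree_act_pre_lie)


section \<open>Generation by one-vertex trees and the universal property\<close>

definition restrict_tree :: "nat set \<Rightarrow> nat \<Rightarrow> ('x, 'w) dtree \<Rightarrow> ('x, 'w) dtree" where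
  "restrict_tree V r T = T\<lparr>verts := V, troot := r, edges := edges T \<inter> V \<times> V\<rparr>"

lemma restrict_tree_sel [simp]:
  "verts (restrict_tree V r T) = V" "troot (restrict_tree V r T) = r"
  "edges (restrict_tree V r T) = edges T \<inter> V \<times> V"
  "dec (restrict_tree V r T) = dec T" "etype (restrict_tree V r T) = etype T"
  by (simp_all add: restrict_tree_def)

lemma rooted_tree_subtree:
  assumes T: "rooted_tree T" and c: "c \<in> verts T"
  shows "rooted_tree (restrict_tree (descendants T c) c T)"
  unfolding rooted_tree_def restrict_tree_sel
proof (intro conjI ballI allI)
  let ?D = "descendants T c"
  show "finite ?D" by (rule finite_descendants[OF T c])
  show "(u, c) \<notin> edges T \<inter> ?D \<times> ?D" for u using edge_not_rtrancl[OF T] by auto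
  show "\<exists>!u. (u, v) \<in> edges T \<inter> ?D \<times> ?D" if "v \<in> ?D - {c}" for v
  proof -
    from that obtain u where "(c, u) \<in> (edges T)\<^sup>*" "(u, v) \<in> edges T"
      by (auto elim: rtranclE)
    then show ?thesis using unique_parent[OF T] by (auto intro: rtrancl_into_rtrancl)
  qed
  fix v assume "v \<in> ?D"
  then have "(c, v) \<in> (edges T)\<^sup>*" by simp
  then show "(c, v) \<in> (edges T \<inter> ?D \<times> ?D)\<^sup>*"
  proof (induction rule: rtrancl_induct)
    case (step y z)
    then have "(y, z) \<in> edges T \<inter> ?D \<times> ?D" by (auto intro: rtrancl_into_rtrancl)
    with step.IH show ?case by (rule rtrancl_into_rtrancl)
  qed simp
qed auto

lemma troot_not_descendant:
  assumes "rooted_tree T" "c \<noteq> troot T"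
  shows "troot T \<notin> descendants T c"
proof
  assume "troot T \<in> descendants T c"
  then have "(c, troot T) \<in> (edges T)\<^sup>*" by simp
  then show False
    by (rule rtranclE) (use assms rooted_treeD(3)[OF assms(1)] in auto)
qed

text \<open>The complement of the descendants of \<open>c\<close> contains the parents of its
  vertices, so paths from the root to its vertices stay inside.\<close>

lemma rooted_tree_prune:
  assumes T: "rooted_tree T" and c: "c \<noteq> troot T"
  shows "rooted_tree (restrict_tree (verts T - descendants T c) (troot T) T)"
  unfolding rooted_tree_def restrict_tree_sel
proof (intro conjI ballI allI)
  let ?V = "verts T - descendants T c"
  show "finite ?V" using rooted_treeD(1)[OF T] by simp
  show "troot T \<in> ?V" using rooted_treeD(2)[OF T] troot_not_descendant[OF T c] by simp
  show "(u, troot T) \<notin> edges T \<inter> ?V \<times> ?V" for u using rooted_treeD(3)[OF T] by auto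
  have parent: "u \<in> ?V" if "(u, v) \<in> edges T" "v \<in> ?V" for u v
    using that rooted_tree_edgeD[OF T] by (auto intro: rtrancl_into_rtrancl)
  show "\<exists>!u. (u, v) \<in> edges T \<inter> ?V \<times> ?V" if v: "v \<in> ?V - {troot T}" for v
  proof -
    from v obtain u where "(u, v) \<in> edges T" using rooted_treeD(4)[OF T] by blast
    then show ?thesis using v parent unique_parent[OF T] by (intro ex1I[of _ u]) auto
  qed
  fix v assume v: "v \<in> ?V"
  then have "(troot T, v) \<in> (edges T)\<^sup>*" using rooted_treeD(5)[OF T] by simp
  then show "(troot T, v) \<in> (edges T \<inter> ?V \<times> ?V)\<^sup>*" using v
  proof (induction rule: rtrancl_induct)
    case (step y z)
    then have "y \<in> ?V" using parent by blast
    moreover from this have "(y, z) \<in> edges T \<inter> ?V \<times> ?V" using step.hyps(2) step.prems by blast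
    ultimately show ?case using step.IH by (blast intro: rtrancl_into_rtrancl)
  qed simp
qed auto

text \<open>The cut edge starts at the root, so grafting the branch back there multiplies no other
  type and restores the cut edge with its own type.\<close>

lemma graft_subtree_prune:
  assumes T: "rooted_tree T" and c: "(troot T, c) \<in> edges T"
  shows "abs_rtree (graft (etype T (troot T, c)) (restrict_tree (descendants T c) c T) (troot T)
      (restrict_tree (verts T - descendants T c) (troot T) T)) = abs_rtree T"
    (is "abs_rtree ?G = _")
proof -
  define D where "D = descendants T c"
  let ?G = "graft (etype T (troot T, c)) (restrict_tree D c T) (troot T) (restrict_tree (verts T - D) (troot T) T)"
  have c_in: "c \<in> verts T" by (rule rooted_tree_edgeD(2)[OF T c])
  have c_ne: "c \<noteq> troot T" using c rooted_treeD(3)[OF T] by auto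
  have D: "D \<subseteq> verts T" "c \<in> D" "troot T \<notin> D"
    using descendants_subset[OF T c_in] troot_not_descendant[OF T c_ne] by (simp_all add: D_def)
  \<comment> \<open>A vertex of the branch other than \<open>c\<close> has its unique parent inside
    the branch.\<close>
  have into: "u = troot T \<and> v = c" if "(u, v) \<in> edges T" "u \<notin> D" "v \<in> D" for u v
  proof -
    have "(c, v) \<in> (edges T)\<^sup>*" using that by (simp add: D_def)
    then have "v = c"
    proof (cases rule: rtranclE)
      case (step w)
      with unique_parent[OF T that(1)] that(2) show ?thesis by (simp add: D_def)
    qed simp
    then show ?thesis using unique_parent[OF T c] that by blast
  qed
  have out: "v \<in> D" if "(u, v) \<in> edges T" "u \<in> D" for u v
    using that(2) rtrancl_into_rtrancl[OF _ that(1)] by (simp add: D_def)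
  \<comment> \<open>An edge outside the branch would gain a factor if the root were reachable from
    its child; but no edge ends at the root.\<close>
  have root: "(b, troot T) \<notin> (edges T \<inter> V \<times> V)\<^sup>*" if "(a, b) \<in> edges T" for a b V
  proof
    assume "(b, troot T) \<in> (edges T \<inter> V \<times> V)\<^sup>*"
    then show False by (rule rtranclE) (use that rooted_treeD(3)[OF T] in auto)
  qed
  define f where "f v = sum_encode (if v \<in> D then Inl v else Inr v)" for v
  have "is_iso f T ?G"
  proof (rule is_isoI)
    show "bij_betw f (verts T) (verts ?G)"
      by (rule bij_betw_byWitness[where f' = "\<lambda>n. case sum_decode n of Inl a \<Rightarrow> a | Inr b \<Rightarrow> b"])
        (use D in \<open>auto simp: f_def\<close>)
    show "f (troot T) = troot ?G" using D by (simp add: f_def)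
    show "(f u, f v) \<in> edges ?G \<longleftrightarrow> (u, v) \<in> edges T" if "u \<in> verts T" "v \<in> verts T" for u v
      using that D into[of u v] out[of u v] c by (auto simp: f_def)
    show "dec ?G (f v) = dec T v" if "v \<in> verts T" for v
      by (simp add: f_def)
    show "etype ?G (f u, f v) = etype T (u, v)" if "(u, v) \<in> edges T" for u v
      using that into[of u v] out[of u v] root[of u v] by (auto simp: f_def)
  qed
  moreover have "rooted_tree ?G"
    using rooted_tree_subtree[OF T c_in] rooted_tree_prune[OF T c_ne] rooted_treeD(2)[OF T] D
    by (intro rooted_tree_graft) (simp_all add: D_def)
  ultimately show ?thesis using abs_rtree_eqI[OF T] by (simp add: D_def)
qed

section \<open>Generation by the one-vertex trees\<close>

lemma abs_rtree_single_vertex: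
  assumes T: "rooted_tree T" and "children T (troot T) = {}"
  shows "abs_rtree T = bullet (dec T (troot T))"
proof -
  have V: "verts T = {troot T}"
    using descendants_unfold[of T "troot T"] assms(2) by (simp add: descendants_troot[OF T])
  then have "edges T = {}"
    using rooted_tree_edgeD(2)[OF T] rooted_treeD(3)[OF T] by (metis equals0I singletonD surj_pair)
  with V have "is_iso (\<lambda>_. 0) T (single_vertex (dec T (troot T)))"
    by (auto intro!: is_isoI simp: single_vertex_def bij_betw_def inj_on_def)
  then show ?thesis
    using abs_rtree_eqI[OF T rooted_tree_single_vertex] by (simp add: bullet_def)
qed

text \<open>Lexicographic induction on the number of vertices and then on the number of children of
  the root. The branch and the pruned tree have fewer vertices; their grafts away from the root have
  as many vertices as the tree but fewer children at the root.\<close>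

lemma tree_module_generated:
  fixes N :: "(('x, 'w::ab_semigroup_mult) rtree \<Rightarrow>\<^sub>0 'k::comm_ring_1) set"
  assumes N: "tree.subspace N" and gen: "\<And>x. x \<in> X \<Longrightarrow> tree_gen x \<in> N"
    and act: "\<And>\<omega> a b. a \<in> N \<Longrightarrow> b \<in> N \<Longrightarrow> tree_act \<omega> a b \<in> N"
  shows "tree_module X \<subseteq> N"
proof
  have single: "Poly_Mapping.single (abs_rtree T) 1 \<in> N" if "rooted_tree T" "dec T ` verts T \<subseteq> X" for T
    using that
  proof (induction T rule: wf_induct_rule[OF wf_measures[of "[\<lambda>T. card (verts T), \<lambda>T. card (children T (troot T))]"]])
    case (1 T)
    note T = 1(2) and X = 1(3)
    show ?case
    proof (cases "children T (troot T) = {}")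
      case True
      then show ?thesis
        using gen[of "dec T (troot T)"] X rooted_treeD(2)[OF T]
        by (auto simp: abs_rtree_single_vertex[OF T True] tree_gen_def)
    next
      case False
      then obtain c where c: "(troot T, c) \<in> edges T" by auto
      let ?D = "descendants T c"
      define \<omega> S U where "\<omega> = etype T (troot T, c)" and "S = restrict_tree ?D c T"
        and "U = restrict_tree (verts T - ?D) (troot T) T"
      have c_in: "c \<in> verts T" by (rule rooted_tree_edgeD(2)[OF T c])
      have c_ne: "c \<noteq> troot T" using c rooted_treeD(3)[OF T] by auto
      have S: "rooted_tree S" unfolding S_def by (rule rooted_tree_subtree[OF T c_in])
      have U: "rooted_tree U" unfolding U_def by (rule rooted_tree_prune[OF T c_ne])
      have D: "?D \<subseteq> verts T" by (rule descendants_subset[OF T c_in])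
      have dec: "dec S ` verts S \<subseteq> X" "dec U ` verts U \<subseteq> X"
        using X D by (auto simp: S_def U_def)
      have fin: "finite (verts T)" by (rule rooted_treeD(1)[OF T])
      have "verts S \<subset> verts T"
        using D rooted_treeD(2)[OF T] troot_not_descendant[OF T c_ne] by (auto simp: S_def)
      then have "card (verts S) < card (verts T)" by (rule psubset_card_mono[OF fin])
      then have S_in: "Poly_Mapping.single (abs_rtree S) 1 \<in> N"
        using S dec by (intro 1(1)) simp_all
      have "verts U \<subset> verts T" using c_in by (auto simp: U_def)
      then have "card (verts U) < card (verts T)" by (rule psubset_card_mono[OF fin])
      then have U_in: "Poly_Mapping.single (abs_rtree U) 1 \<in> N"
        using U dec by (intro 1(1)) simp_all
      have rest: "Poly_Mapping.single (abs_rtree (graft \<omega> S v U)) 1 \<in> N" if v: "v \<in> verts U - {troot U}" for v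
      proof (rule 1(1))
        have "card (verts (graft \<omega> S v U)) = card (verts S) + card (verts U)"
          using rooted_treeD(1)[OF S] rooted_treeD(1)[OF U]
          by (simp add: card_image[OF inj_sum_encode] card_Plus)
        also have "\<dots> = card (verts T)"
          using fin D by (simp add: S_def U_def card_Diff_subset finite_subset card_mono)
        finally have V: "card (verts (graft \<omega> S v U)) = card (verts T)" .
        have "children (graft \<omega> S v U) (troot (graft \<omega> S v U)) = (sum_encode \<circ> Inr) ` children U (troot U)"
          using v by (simp add: children_graft)
        then have "card (children (graft \<omega> S v U) (troot (graft \<omega> S v U))) \<le> card (children U (troot U))"
          using card_image_le[OF finite_children[OF U]] by simp
        also have "children U (troot U) \<subset> children T (troot T)"
          using c by (auto simp: U_def)
        then have "card (children U (troot U)) < card (children T (troot T))"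
          by (rule psubset_card_mono[OF finite_children[OF T]])
        finally show "(graft \<omega> S v U, T) \<in> measures [\<lambda>T. card (verts T), \<lambda>T. card (children T (troot T))]"
          using V by simp
        show "rooted_tree (graft \<omega> S v U)" using S U v by (intro rooted_tree_graft) auto
        show "dec (graft \<omega> S v U) ` verts (graft \<omega> S v U) \<subseteq> X"
          unfolding dec_graft using dec by simp
      qed
      have "tree_act \<omega> (Poly_Mapping.single (abs_rtree S) 1) (Poly_Mapping.single (abs_rtree U) 1) =
          (Poly_Mapping.single (abs_rtree (graft \<omega> S (troot U) U)) 1 :: ('x, 'w) rtree \<Rightarrow>\<^sub>0 'k) +
          (\<Sum>v\<in>verts U - {troot U}. Poly_Mapping.single (abs_rtree (graft \<omega> S v U)) 1)"
        unfolding tree_act_single[OF S U]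
        by (rule sum.remove[OF rooted_treeD(1,2)[OF U]])
      moreover have "abs_rtree (graft \<omega> S (troot U) U) = abs_rtree T"
        unfolding \<omega>_def S_def U_def using graft_subtree_prune[OF T c] by simp
      \<comment> \<open>The graft at the root is the tree itself; solving for it takes only a
        subtraction, so no coefficient has to be inverted.\<close>
      ultimately have "Poly_Mapping.single (abs_rtree T) 1 =
          tree_act \<omega> (Poly_Mapping.single (abs_rtree S) (1::'k)) (Poly_Mapping.single (abs_rtree U) 1) -
          (\<Sum>v\<in>verts U - {troot U}. Poly_Mapping.single (abs_rtree (graft \<omega> S v U)) 1)"
        by simp
      then show ?thesis
        by (simp only: tree.subspace_diff[OF N act[OF S_in U_in] tree.subspace_sum[OF N rest]])
    qed
  qed
  fix a :: "('x, 'w) rtree \<Rightarrow>\<^sub>0 'k" assume a: "a \<in> tree_module X"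
  have "Poly_Mapping.single t 1 \<in> N" if "t \<in> Poly_Mapping.keys a" for t
  proof -
    obtain T where T: "rooted_tree T" "t = abs_rtree T" by (rule rtree_cases)
    moreover have "t \<in> trees X" using a that by (auto simp: tree_module_def)
    ultimately show ?thesis using single[of T] by (simp add: trees_def decorations_abs)
  qed
  then have "(\<Sum>t\<in>Poly_Mapping.keys a. tree_scale (Poly_Mapping.lookup a t) (Poly_Mapping.single t 1)) \<in> N"
    by (intro tree.subspace_sum[OF N] tree.subspace_scale[OF N])
  then show "a \<in> N" using poly_mapping_sum_single[of a] by metis
qed

section \<open>The universal map and its uniqueness\<close>

sublocale pre_lie_family_algebra \<subseteq> linear_extension scale ..

context pre_lie_family_algebra
begin

text \<open>Evaluates a chosen representative; \<open>tree_value_abs\<close> allows any rooted one,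
  by invariance under isomorphism.\<close>

definition tree_value :: "('x \<Rightarrow> 'a) \<Rightarrow> ('x, 'w) rtree \<Rightarrow> 'a" where
  "tree_value \<psi> t = value_at \<psi> (rep_rtree t) (troot (rep_rtree t))"

lemma tree_value_abs:
  assumes T: "rooted_tree T"
  shows "tree_value \<psi> (abs_rtree T) = value_at \<psi> T (troot T)"
proof -
  have "tree_iso (rep_rtree (abs_rtree T)) T"
    by (rule Quotient_rep_abs[OF Quotient_rtree tree_iso_refl[OF T]])
  then obtain f where R: "rooted_tree (rep_rtree (abs_rtree T))" and f: "is_iso f (rep_rtree (abs_rtree T)) T"
    by (auto simp: tree_iso_def)
  show ?thesis
    using value_at_iso[OF f R T rooted_treeD(2)[OF R]] by (simp add: tree_value_def is_isoD(2)[OF f])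
qed

lemma tree_value_closed:
  assumes "\<psi> \<in> X \<rightarrow> A" "t \<in> trees X"
  shows "tree_value \<psi> t \<in> A"
proof -
  obtain T where T: "rooted_tree T" "t = abs_rtree T" by (rule rtree_cases)
  then show ?thesis
    using assms value_at_closed[OF T(1) assms(1) _ rooted_treeD(2)[OF T(1)]]
    by (simp add: tree_value_abs trees_def decorations_abs)
qed

lemma tree_value_bullet:
  fixes \<psi> :: "'x \<Rightarrow> 'a"
  shows "tree_value \<psi> (bullet x) = \<psi> x"
proof -
  let ?V = "single_vertex x :: ('x, 'w) dtree"
  have "children ?V (troot ?V) = {}" "dec ?V (troot ?V) = x"
    by (simp_all add: children_def single_vertex_def)
  then show ?thesis
    using value_at_unfold[OF rooted_tree_single_vertex, of \<psi> x "troot ?V"]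
    by (simp add: bullet_def tree_value_abs rooted_tree_single_vertex brace_empty)
qed

text \<open>This is \<open>sum_value_at_graft\<close> at the root, whose descendants are all
  vertices.\<close>

lemma lin_tree_value_graft_sum:
  assumes \<psi>: "\<psi> \<in> X \<rightarrow> A" and s: "s \<in> trees X" and t: "t \<in> trees X"
  shows "lin (tree_value \<psi>) (graft_sum \<omega> s t) = act \<omega> (tree_value \<psi> s) (tree_value \<psi> t)"
proof -
  obtain S where S: "rooted_tree S" "s = abs_rtree S" by (rule rtree_cases)
  obtain T where T: "rooted_tree T" "t = abs_rtree T" by (rule rtree_cases)
  have X: "dec S ` verts S \<subseteq> X" "dec T ` verts T \<subseteq> X"
    using s t S T by (simp_all add: trees_def decorations_abs)
  have "lin (tree_value \<psi>) (graft_sum \<omega> s t) =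
      (\<Sum>v\<in>verts T. value_at \<psi> (graft \<omega> S v T) (sum_encode (Inr (troot T))))"
    using S T by (simp add: graft_sum.abs_eq tree_iso_refl lin_sum tree_value_abs rooted_tree_graft)
  also have "\<dots> = act \<omega> (tree_value \<psi> s) (tree_value \<psi> t)"
    using sum_value_at_graft[OF S(1) T(1) \<psi> X rooted_treeD(2)[OF T(1)]] S T
    by (simp add: descendants_troot tree_value_abs)
  finally show ?thesis .
qed

text \<open>The laws of the algebra hold on \<open>A\<close> only, hence the conditions on the
  supports.\<close>

lemma act_lin:
  assumes "\<And>s. s \<in> Poly_Mapping.keys a \<Longrightarrow> f s \<in> A" "\<And>t. t \<in> Poly_Mapping.keys b \<Longrightarrow> g t \<in> A"
  shows "act \<omega> (lin f a) (lin g b) = lin (\<lambda>s. lin (\<lambda>t. act \<omega> (f s) (g t)) b) a"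
proof -
  have "act \<omega> (lin f a) (lin g b) = lin (\<lambda>s. act \<omega> (f s) (lin g b)) a"
    using assms lin_in_subspace[OF carrier, of b g]
    by (simp add: lin_def[of f] lin_def[of "\<lambda>s. act \<omega> (f s) (lin g b)"] act_sum_left act_scale_left A_scale)
  also have "\<dots> = lin (\<lambda>s. lin (\<lambda>t. act \<omega> (f s) (g t)) b) a"
    using assms by (auto simp: lin_def act_sum_right act_scale_right A_scale intro!: sum.cong)
  finally show ?thesis .
qed

lemma lin_tree_lin: "lin f (tree.lin h a) = lin (\<lambda>s. lin f (h s)) a"
  by (simp add: tree.lin_def lin_sum lin_scale lin_def[of "\<lambda>s. lin f (h s)"])

lemma lin_tree_value_act:
  assumes \<psi>: "\<psi> \<in> X \<rightarrow> A" and a: "a \<in> tree_module X" and b: "b \<in> tree_module X"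
  shows "lin (tree_value \<psi>) (tree_act \<omega> a b) = act \<omega> (lin (tree_value \<psi>) a) (lin (tree_value \<psi>) b)"
proof -
  have ab: "s \<in> Poly_Mapping.keys a \<Longrightarrow> s \<in> trees X" "s \<in> Poly_Mapping.keys b \<Longrightarrow> s \<in> trees X" for s
    using a b by (auto simp: tree_module_def)
  have "lin (tree_value \<psi>) (tree_act \<omega> a b) = lin (\<lambda>s. lin (\<lambda>t. lin (tree_value \<psi>) (graft_sum \<omega> s t)) b) a"
    by (simp add: tree_act_eq_lin lin_tree_lin)
  also have "\<dots> = lin (\<lambda>s. lin (\<lambda>t. act \<omega> (tree_value \<psi> s) (tree_value \<psi> t)) b) a"
    unfolding lin_def[of _ a] lin_def[of _ b]
    using lin_tree_value_graft_sum[OF \<psi>] ab by (auto intro!: sum.cong)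
  also have "\<dots> = act \<omega> (lin (tree_value \<psi>) a) (lin (tree_value \<psi>) b)"
    using tree_value_closed[OF \<psi>] ab by (intro act_lin[symmetric]) auto
  finally show ?thesis .
qed

text \<open>Existence is the linear extension of \<open>tree_value\<close>. For uniqueness, the
  elements where two solutions agree form a submodule closed under the operations and containing the
  generators, hence everything.\<close>

lemma tree_module_universal:
  assumes \<psi>: "\<psi> \<in> X \<rightarrow> A"
  shows "\<exists>!\<phi> :: (('x, 'w) rtree \<Rightarrow>\<^sub>0 'k) \<Rightarrow> 'a.
          \<phi> \<in> tree_module X \<rightarrow>\<^sub>E A \<and>
          (\<forall>a\<in>tree_module X. \<forall>b\<in>tree_module X. \<phi> (a + b) = \<phi> a + \<phi> b) \<and>
          (\<forall>c. \<forall>a\<in>tree_module X. \<phi> (tree_scale c a) = scale c (\<phi> a)) \<and>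
          (\<forall>\<omega>. \<forall>a\<in>tree_module X. \<forall>b\<in>tree_module X.
             \<phi> (tree_act \<omega> a b) = act \<omega> (\<phi> a) (\<phi> b)) \<and>
          (\<forall>x\<in>X. \<phi> (tree_gen x) = \<psi> x)" (is "\<exists>!\<phi>. ?P \<phi>")
proof (rule ex_ex1I)
  let ?M = "tree_module X :: (('x, 'w) rtree \<Rightarrow>\<^sub>0 'k) set"
  note sub = tree_module_subspace[of X]
  have gen_in: "tree_gen x \<in> ?M" if "x \<in> X" for x
    using bullet_in_trees[OF that] by (auto simp: tree_module_def tree_gen_def)
  have closed: "lin (tree_value \<psi>) a \<in> A" if "a \<in> ?M" for a
    using that tree_value_closed[OF \<psi>] by (intro lin_in_subspace[OF carrier]) (auto simp: tree_module_def)
  have gen: "lin (tree_value \<psi>) (tree_gen x) = \<psi> x" for x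
    by (simp add: tree_gen_def tree_value_bullet)
  show "\<exists>\<phi>. ?P \<phi>"
    \<comment> \<open>Uniqueness as an equality of functions forces a fixed value outside
      \<open>tree_module X\<close>, hence \<open>restrict\<close>.\<close>
    by (rule exI[of _ "restrict (lin (tree_value \<psi>)) ?M"])
      (auto simp: closed gen_in tree.subspace_add[OF sub] tree.subspace_scale[OF sub] tree_act_closed
        lin_add lin_scale lin_tree_value_act[OF \<psi>] gen)
  fix \<phi> \<phi>' assume P: "?P \<phi>" and P': "?P \<phi>'"
  have scale0: "\<chi> 0 = 0" if "?P \<chi>" for \<chi>
  proof -
    have "\<chi> (tree_scale 0 0) = scale 0 (\<chi> 0)" using that tree.subspace_0[OF sub] by blast
    then show ?thesis by simp
  qed
  have "?M \<subseteq> {a \<in> ?M. \<phi> a = \<phi>' a}"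
  proof (rule tree_module_generated)
    show "tree.subspace {a \<in> ?M. \<phi> a = \<phi>' a}"
      using P P' scale0[OF P] scale0[OF P']
      by (intro tree.subspaceI)
        (auto simp: tree.subspace_0[OF sub] tree.subspace_add[OF sub] tree.subspace_scale[OF sub])
  qed (use P P' gen_in tree_act_closed in auto)
  then show "\<phi> = \<phi>'"
    using P P' by (intro PiE_ext[of \<phi> ?M "\<lambda>_. A" \<phi>']) auto
qed

end

theorem theorem3p16:
  fixes X :: "'x set"
  shows "pre_lie_family_algebra tree_scale
      (tree_module X :: (('x, 'w::ab_semigroup_mult) rtree \<Rightarrow>\<^sub>0 'k::comm_ring_1) set) tree_act \<and>
    (tree_gen :: 'x \<Rightarrow> (('x, 'w) rtree \<Rightarrow>\<^sub>0 'k)) \<in> X \<rightarrow> tree_module X \<and>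
    (\<forall>(scale :: 'k \<Rightarrow> 'a::ab_group_add \<Rightarrow> 'a) (A :: 'a set) (act :: 'w \<Rightarrow> 'a \<Rightarrow> 'a \<Rightarrow> 'a) (\<psi> :: 'x \<Rightarrow> 'a).
       pre_lie_family_algebra scale A act \<and> \<psi> \<in> X \<rightarrow> A \<longrightarrow>
       (\<exists>!\<phi> :: (('x, 'w) rtree \<Rightarrow>\<^sub>0 'k) \<Rightarrow> 'a.
          \<phi> \<in> tree_module X \<rightarrow>\<^sub>E A \<and>
          (\<forall>a\<in>tree_module X. \<forall>b\<in>tree_module X. \<phi> (a + b) = \<phi> a + \<phi> b) \<and>
          (\<forall>c. \<forall>a\<in>tree_module X. \<phi> (tree_scale c a) = scale c (\<phi> a)) \<and>
          (\<forall>\<omega>. \<forall>a\<in>tree_module X. \<forall>b\<in>tree_module X.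
             \<phi> (tree_act \<omega> a b) = act \<omega> (\<phi> a) (\<phi> b)) \<and>
          (\<forall>x\<in>X. \<phi> (tree_gen x) = \<psi> x)))"
proof (intro conjI allI impI pre_lie_family_algebra_tree_module)
  show "(tree_gen :: 'x \<Rightarrow> (('x, 'w) rtree \<Rightarrow>\<^sub>0 'k)) \<in> X \<rightarrow> tree_module X"
    using bullet_in_trees by (auto simp: tree_module_def tree_gen_def)
qed (elim conjE, rule pre_lie_family_algebra.tree_module_universal)

end
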